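(* Let $n\ge3$, let $U\subset\mathbb{R}^n$ be open, $X\in C^2(U,\mathbb{R}^n)$, $p\in U$ with $X(p)=0$, $J:=DX(p)$, and assume $\operatorname{rank}J=n-1$, $e_{n-1}(J)=0$, $e_{n-2}(J)\neq0$. Let $q_0$ span $\ker J$, let $(a,b)$ be the Bogdanov--Takens coefficients associated with $(X,p,q_0)$, and write $D_{q_0}e_k:=\frac{d}{ds}\big|_{s=0}e_k(DX(p+sq_0))$. Then for $0\le\rho\le n-1$, $$(-1)^{n-\rho}D_{q_0}e_{n-\rho}=-\bigl(2a\,c_\rho+b\,c_{\rho-1}\bigr)-t_{\rho-2}.$$ The cases $\rho=0,1$ are $D_{q_0}e_n=-2a\,e_{n-2}(J)$ and $D_{q_0}e_{n-1}=b\,e_{n-2}(J)-2a\,e_{n-3}(J)$, so that $D_{q_0}e_n$ and $D_{q_0}e_{n-1}$ are determined by $J$ and $(a,b)$ alone. The case $\rho=n-1$ is the identity $$D_{q_0}e_1=b+\operatorname{tr}L_{\mathrm{tr}}.$$ Moreover $L_{\mathrm{tr}}$ is an arbitrary endomorphism of $E^{\mathrm{tr}}$: given $J$ (with $\operatorname{rank}J=n-1$, $e_{n-1}(J)=0$, $e_{n-2}(J)\ne0$, and $q_0$ spanning $\ker J$) and any linear map $L:\mathbb{R}^n\to\mathbb{R}^n$, there is a $C^\infty$ vector field $X$ with $X(p)=0$, $DX(p)=J$ and $\frac{d}{ds}\big|_{s=0}DX(p+sq_0)=L$.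
   Context: For a real $m\times m$ matrix $A$, $e_k(A)$ is the sum of the principal $k\times k$ minors of $A$, so that $\chi_A(\lambda):=\det(\lambda I-A)=\sum_{k=0}^m(-1)^k e_k(A)\lambda^{m-k}$; $e_0=1$, $e_k:=0$ for $k<0$. $\operatorname{adj}$ is the adjugate. Under the stated conditions on $J$, $\mathbb{R}^n=E^c\oplus E^{\mathrm{tr}}$ with $E^c:=\ker J^2$, $E^{\mathrm{tr}}:=\operatorname{im}J^2$, both $J$-invariant, $\dim E^c=2$, $J|_{E^c}$ nilpotent of rank one, and $J_{\mathrm{tr}}:=J|_{E^{\mathrm{tr}}}$ invertible. Let $B(u,v):=D^2X(p)[u,v]$, $L:=\frac{d}{ds}\big|_{s=0}DX(p+sq_0)$ (so $Lw=B(q_0,w)$) and $L_{\mathrm{tr}}:=\Pi_{\mathrm{tr}}L|_{E^{\mathrm{tr}}}$, with $\Pi_{\mathrm{tr}}$ the projection onto $E^{\mathrm{tr}}$ along $E^c$. Put $\nu:=n-2$, $\chi_{J_{\mathrm{tr}}}(\lambda)=\sum_{j=0}^{n-2}c_j\lambda^j$, $\operatorname{adj}(\lambda I-J_{\mathrm{tr}})=\sum_{j=0}^{\nu-1}A_j\lambda^j$, $t_j:=\operatorname{tr}(A_jL_{\mathrm{tr}})$, with $c_j:=0$ for $j<0$ or $j>n-2$ and $A_j:=0$, $t_j:=0$ for $j<0$ or $j>\nu-1$. Definition of $(a,b)$: choose $q_1\in E^c$ with $Jq_1=q_0$; let $p_0,p_1$ be the covectors determined by $\langle p_0,q_0\rangle=\langle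 p_1,q_1\rangle=1$, $\langle p_0,q_1\rangle=\langle p_1,q_0\rangle=0$, $p_0|_{E^{\mathrm{tr}}}=p_1|_{E^{\mathrm{tr}}}=0$. Then $a:=\tfrac12\langle p_1,B(q_0,q_0)\rangle$, $b:=\langle p_0,B(q_0,q_0)\rangle+\langle p_1,B(q_0,q_1)\rangle$; the pair does not depend on the choice of $q_1$. *)

theory Defs
  imports "HOL-Analysis.Analysis" "Jordan_Normal_Form.Char_Poly"
begin

text \<open>
  Constants whose names exist both in HOL-Analysis and in \<open>Jordan_Normal_Form\<close> are written with
  their theory name. Matrices acting on the ambient space have type \<open>real^'n^'n\<close>; the dimension of
  \<open>E\<^sup>t\<^sup>r\<close> is \<open>CARD('n) - 2\<close>, so endomorphisms of \<open>E\<^sup>t\<^sup>r\<close> are represented by \<open>Jordan_Normal_Form\<close>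
  matrices with respect to a basis given as a list of vectors.
\<close>


subsection \<open>Differentiability classes\<close>

text \<open>\<open>f\<close> is \<open>C\<^sup>k\<^sup>+\<^sup>1\<close> on the open set \<open>U\<close> iff it is differentiable there and every directional
  derivative is \<open>C\<^sup>k\<close>; on finite-dimensional spaces this is the usual notion.\<close>

fun Ck_on :: "nat \<Rightarrow> 'a::real_normed_vector set \<Rightarrow> ('a \<Rightarrow> 'b::real_normed_vector) \<Rightarrow> bool" where
  "Ck_on 0 U f \<longleftrightarrow> continuous_on U f"
| "Ck_on (Suc k) U f \<longleftrightarrow>
     (\<forall>x\<in>U. f differentiable (at x)) \<and>
     (\<forall>v. Ck_on k U (\<lambda>x. frechet_derivative f (at x) v))"

definition smooth_on :: "'a::real_normed_vector set \<Rightarrow> ('a \<Rightarrow> 'b::real_normed_vector) \<Rightarrow> bool" where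
  "smooth_on U f \<longleftrightarrow> (\<forall>k. Ck_on k U f)"


subsection \<open>Sums of principal minors\<close>

text \<open>The Leibniz formula for the determinant of the submatrix of \<open>A\<close> with rows and columns in \<open>S\<close>.\<close>

definition principal_minor :: "real^'n^'n \<Rightarrow> 'n::finite set \<Rightarrow> real" where
  "principal_minor A S =
     (\<Sum>\<sigma> | \<sigma> permutes S. of_int (sign \<sigma>) * (\<Prod>i\<in>S. vec_nth (vec_nth A i) (\<sigma> i)))"

text \<open>\<open>e\<^sub>k(A)\<close>; zero for \<open>k > n\<close>.\<close>

definition minor_sum :: "nat \<Rightarrow> real^'n^'n \<Rightarrow> real" where
  "minor_sum k A = (\<Sum>S | S \<subseteq> (UNIV :: 'n::finite set) \<and> card S = k. principal_minor A S)"


subsection \<open>The splitting into centre and transverse part\<close>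

definition E_c :: "real^'n^'n \<Rightarrow> (real^'n::finite) set" where
  "E_c J = {v. (J ** J) *v v = 0}"

definition E_tr :: "real^'n^'n \<Rightarrow> (real^'n::finite) set" where
  "E_tr J = range (\<lambda>v. (J ** J) *v v)"

definition proj_along :: "'a::ab_group_add set \<Rightarrow> 'a set \<Rightarrow> 'a \<Rightarrow> 'a" where
  "proj_along E F v = (THE w. w \<in> E \<and> v - w \<in> F)"

text \<open>\<open>\<Pi>\<^sub>t\<^sub>r M\<close>, to be regarded as an endomorphism of \<open>E_tr J\<close>. On \<open>E_tr J\<close> it agrees with \<open>J\<close> itself
  for \<open>M = J\<close>.\<close>

definition tr_part :: "real^'n^'n \<Rightarrow> real^'n^'n \<Rightarrow> real^'n \<Rightarrow> real^'n::finite" where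
  "tr_part J M w = proj_along (E_tr J) (E_c J) (M *v w)"

definition endomorphism_of :: "'a::real_vector set \<Rightarrow> ('a \<Rightarrow> 'a) \<Rightarrow> bool" where
  "endomorphism_of E f \<longleftrightarrow>
     (\<forall>x\<in>E. f x \<in> E) \<and>
     (\<forall>x\<in>E. \<forall>y\<in>E. f (x + y) = f x + f y) \<and>
     (\<forall>r. \<forall>x\<in>E. f (r *\<^sub>R x) = r *\<^sub>R f x)"


subsection \<open>Derivatives of the vector field\<close>

text \<open>\<open>D\<^sup>2X(p)[u,v]\<close>\<close>

definition D2 :: "(real^'n \<Rightarrow> real^'n) \<Rightarrow> real^'n \<Rightarrow> real^'n \<Rightarrow> real^'n \<Rightarrow> real^'n::finite" where
  "D2 X p u v = frechet_derivative (\<lambda>x. frechet_derivative X (at x) v) (at p) u"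

definition dir_jacobian :: "(real^'n \<Rightarrow> real^'n) \<Rightarrow> real^'n \<Rightarrow> real^'n \<Rightarrow> real^'n^'n::finite" where
  "dir_jacobian X p q = vector_derivative (\<lambda>s. jacobian X (at (p + s *\<^sub>R q))) (at 0)"

definition dir_e :: "(real^'n \<Rightarrow> real^'n) \<Rightarrow> real^'n \<Rightarrow> real^'n::finite \<Rightarrow> nat \<Rightarrow> real" where
  "dir_e X p q k = deriv (\<lambda>s. minor_sum k (jacobian X (at (p + s *\<^sub>R q)))) 0"


subsection \<open>Bogdanov--Takens coefficients\<close>

text \<open>A relation rather than a function, because of the auxiliary choice of \<open>q1\<close>.\<close>

definition BT_coefficients ::
    "(real^'n \<Rightarrow> real^'n) \<Rightarrow> real^'n \<Rightarrow> real^'n::finite \<Rightarrow> real \<Rightarrow> real \<Rightarrow> bool" where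
  "BT_coefficients X p q0 a b \<longleftrightarrow>
     (let J = jacobian X (at p); B = D2 X p in
      \<exists>q1 p0 p1. q1 \<in> E_c J \<and> J *v q1 = q0 \<and>
        linear p0 \<and> linear p1 \<and>
        p0 q0 = 1 \<and> p1 q1 = 1 \<and> p0 q1 = 0 \<and> p1 q0 = 0 \<and>
        (\<forall>w\<in>E_tr J. p0 w = 0) \<and> (\<forall>w\<in>E_tr J. p1 w = 0) \<and>
        a = 1/2 * p1 (B q0 q0) \<and>
        b = p0 (B q0 q0) + p1 (B q0 q1))"


subsection \<open>Characteristic polynomial and adjugate of the transverse part\<close>

definition is_basis :: "'a::real_vector list \<Rightarrow> 'a set \<Rightarrow> bool" where
  "is_basis ws E \<longleftrightarrow> distinct ws \<and> independent (set ws) \<and> span (set ws) = E"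

definition coord_mat :: "'a::real_vector list \<Rightarrow> ('a \<Rightarrow> 'a) \<Rightarrow> real mat" where
  "coord_mat ws f =
     Matrix.mat (length ws) (length ws)
       (\<lambda>(i, j). representation (set ws) (f (ws ! j)) (ws ! i))"

definition tr_mat :: "'a::comm_monoid_add mat \<Rightarrow> 'a" where
  "tr_mat M = (\<Sum>i<dim_row M. M $$ (i, i))"

text \<open>Coefficients with index above the degree vanish automatically; negative indices have to be
  excluded explicitly.\<close>

definition char_coeff :: "real mat \<Rightarrow> int \<Rightarrow> real" where
  "char_coeff M j = (if j < 0 then 0 else coeff (char_poly M) (nat j))"

text \<open>\<open>char_poly_matrix M\<close> is \<open>\<lambda>I - M\<close> over the polynomial ring.\<close>

definition adj_coeff :: "real mat \<Rightarrow> int \<Rightarrow> real mat" where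
  "adj_coeff M j =
     (if j < 0 then 0\<^sub>m (dim_row M) (dim_row M)
      else map_mat (\<lambda>f. coeff f (nat j)) (adj_mat (char_poly_matrix M)))"

end

theory Submission
  imports Defs
begin

text \<open>
  Differentiating \<open>det (x - DX(p + s q\<^sub>0))\<close> at \<open>s = 0\<close> by Jacobi's formula gives
  \<open>-tr (adj (x - J) L)\<close> on the one hand and the generating polynomial of the numbers
  \<open>(-1)^k D e\<^sub>k\<close> on the other. In a basis \<open>q\<^sub>0, q\<^sub>1, w\<^sub>1, \<dots>\<close> adapted to \<open>E\<^sup>c \<oplus> E\<^sup>t\<^sup>r\<close> the matrix
  of \<open>x - J\<close> is block diagonal, so the trace equals
  \<open>(2 a + b x) \<chi>(x) + x^2 tr (adj (x - J\<^sub>t\<^sub>r) L\<^sub>t\<^sub>r)\<close> with \<open>\<chi>\<close> the characteristic polynomial of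
  \<open>J\<^sub>t\<^sub>r\<close>, and coefficients are compared. The existence of dual covectors \<open>p\<^sub>0, p\<^sub>1\<close> already forces
  the sum \<open>E\<^sup>c + E\<^sup>t\<^sup>r\<close> to be direct; without them directness comes from \<open>e\<^sub>n\<^sub>-\<^sub>2(J) \<noteq> 0\<close>.
\<close>

no_notation vec_index (infixl "$" 100)

subsection \<open>Characteristic polynomials and changes of basis\<close>

text \<open>Expanding each product \<open>\<Prod>i. ?d p i - A $ i $ p i\<close> over the set
  \<open>S\<close> of indices at which the factor from \<open>A\<close> is chosen splits the Leibniz
  sum by \<open>S\<close>. The inner sum over permutations is then a principal minor, and grouping
  by \<open>card S\<close> yields the coefficients.\<close>

lemma det_mat_minus:
  fixes A :: "real^'n::finite^'n"
  shows "Determinants.det (Finite_Cartesian_Product.mat x - A) =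
    (\<Sum>k\<le>CARD('n). (-1) ^ k * minor_sum k A * x ^ (CARD('n) - k))"
proof -
  let ?P = "{p. p permutes (UNIV :: 'n set)}"
  let ?d = "\<lambda>p i. if i = p i then x else (0::real)"
  let ?m = "\<lambda>S. (-1) ^ card S * principal_minor A S * x ^ (CARD('n) - card S)"
  have entry: "(Finite_Cartesian_Product.mat x - A) $ i $ p i = ?d p i - A $ i $ p i" for p :: "'n \<Rightarrow> 'n" and i
    by (simp add: Finite_Cartesian_Product.mat_def)
  \<comment> \<open>A permutation moving some index outside \<open>S\<close> picks up an
    off-diagonal zero of \<open>mat x\<close>, so only permutations of \<open>S\<close> survive,
    each with a factor \<open>x\<close> for every index outside \<open>S\<close>.\<close>
  have S: "(\<Sum>p\<in>?P. of_int (sign p) * ((-1) ^ card S * (\<Prod>i\<in>S. A $ i $ p i) * (\<Prod>i\<in>UNIV - S. ?d p i)))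
      = ?m S" for S :: "'n set"
  proof -
    have "(\<Sum>p\<in>?P. of_int (sign p) * ((-1) ^ card S * (\<Prod>i\<in>S. A $ i $ p i) * (\<Prod>i\<in>UNIV - S. ?d p i)))
      = (\<Sum>p | p permutes S. (-1) ^ card S * x ^ (CARD('n) - card S) * (of_int (sign p) * (\<Prod>i\<in>S. A $ i $ p i)))"
    proof (rule sum.mono_neutral_cong_right)
      show "finite ?P" by (simp add: finite_permutations)
      show "{p. p permutes S} \<subseteq> ?P" using permutes_subset by blast
      show "\<forall>p\<in>?P - {p. p permutes S}.
        of_int (sign p) * ((-1) ^ card S * (\<Prod>i\<in>S. A $ i $ p i) * (\<Prod>i\<in>UNIV - S. ?d p i)) = 0"
      proof
        fix p assume p: "p \<in> ?P - {p. p permutes S}"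
        then obtain i where "i \<notin> S" "p i \<noteq> i" by (auto simp: permutes_def)
        then have "(\<Prod>i\<in>UNIV - S. ?d p i) = 0" by (intro prod_zero) (auto intro!: bexI[of _ i])
        then show "of_int (sign p) * ((-1) ^ card S * (\<Prod>i\<in>S. A $ i $ p i) * (\<Prod>i\<in>UNIV - S. ?d p i)) = 0"
          by simp
      qed
      fix p assume "p \<in> {p. p permutes S}"
      then have "(\<Prod>i\<in>UNIV - S. ?d p i) = (\<Prod>i\<in>UNIV - S. x)"
        by (intro prod.cong) (auto simp: permutes_def)
      also have "\<dots> = x ^ (CARD('n) - card S)" by (simp add: card_Diff_subset)
      finally show "of_int (sign p) * ((-1) ^ card S * (\<Prod>i\<in>S. A $ i $ p i) * (\<Prod>i\<in>UNIV - S. ?d p i)) =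
        (-1) ^ card S * x ^ (CARD('n) - card S) * (of_int (sign p) * (\<Prod>i\<in>S. A $ i $ p i))" by simp
    qed
    then show ?thesis by (simp add: principal_minor_def sum_distrib_left mult_ac)
  qed
  have "Determinants.det (Finite_Cartesian_Product.mat x - A) =
      (\<Sum>p\<in>?P. of_int (sign p) * (\<Prod>i\<in>UNIV. ?d p i - A $ i $ p i))"
    unfolding Determinants.det_def entry ..
  also have "\<dots> = (\<Sum>p\<in>?P. \<Sum>S\<in>UNIV.
      of_int (sign p) * ((-1) ^ card S * (\<Prod>i\<in>S. A $ i $ p i) * (\<Prod>i\<in>UNIV - S. ?d p i)))"
    by (simp add: prod_diff_conv_sum sum_distrib_left)
  also have "\<dots> = (\<Sum>S\<in>UNIV. ?m S)" by (subst sum.swap) (simp add: S)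
  also have "\<dots> = (\<Sum>k\<le>CARD('n). \<Sum>S | S \<in> UNIV \<and> card S = k. ?m S)"
    by (rule sum.group[symmetric]) (auto simp: card_mono)
  also have "\<dots> = (\<Sum>k\<le>CARD('n). (-1) ^ k * minor_sum k A * x ^ (CARD('n) - k))"
    by (intro sum.cong refl) (simp add: minor_sum_def sum_distrib_left sum_distrib_right)
  finally show ?thesis .
qed

text \<open>Transfers between determinants indexed by numbers and by a finite type. Conjugation with
  \<open>g\<close> is a bijection between the two permutation groups and preserves both the sign and
  the product of entries.\<close>

lemma det_reindex:
  fixes A :: "'a::comm_ring_1^'n::finite^'n"
  assumes g: "bij_betw g {..<n} (UNIV :: 'n set)"
  shows "Determinant.det (Matrix.mat n n (\<lambda>(i, j). A $ g i $ g j)) = Determinants.det A"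
proof -
  let ?I = "{0..<n}"
  have g: "bij_betw g ?I (UNIV :: 'n set)" using g by (simp add: lessThan_atLeast0)
  then have inj: "inj_on g ?I" and im: "g ` ?I = UNIV" by (auto simp: bij_betw_def)
  have g': "bij_betw (inv_into ?I g) (UNIV :: 'n set) ?I" by (rule bij_betw_inv_into[OF g])
  show ?thesis unfolding Determinants.det_def
  proof (subst det_def'[where n = n], simp, rule sum.reindex_bij_witness[where
        i = "map_permutation UNIV (inv_into ?I g)" and j = "map_permutation ?I g"])
    fix p assume p: "p \<in> {p. p permutes ?I}"
    then have p': "p permutes ?I" by simp
    show "map_permutation ?I g p \<in> {p. p permutes UNIV}"
      using map_permutation_permutes[OF g p'] by simp
    show "map_permutation UNIV (inv_into ?I g) (map_permutation ?I g p) = p"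
      using map_permutation_compose_inv[OF g p'] g by (simp add: bij_betw_def)
    have "(\<Prod>i\<in>UNIV. A $ i $ map_permutation ?I g p i) = (\<Prod>i\<in>?I. A $ g i $ map_permutation ?I g p (g i))"
      by (rule prod.reindex_bij_betw[OF g, symmetric])
    also have "\<dots> = (\<Prod>i\<in>?I. Matrix.mat n n (\<lambda>(i, j). A $ g i $ g j) $$ (i, p i))"
      using permutes_in_image[OF p'] by (intro prod.cong refl) (auto simp: map_permutation_apply[OF inj])
    finally show "of_int (sign (map_permutation ?I g p)) * (\<Prod>i\<in>UNIV. A $ i $ map_permutation ?I g p i) =
      of_int (sign p) * (\<Prod>i = 0..<n. Matrix.mat n n (\<lambda>(i, j). A $ g i $ g j) $$ (i, p i))"
      by (simp add: sign_map_permutation[OF inj p'])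
  next
    fix p assume "p \<in> {p. p permutes (UNIV :: 'n set)}"
    then have p': "p permutes (UNIV :: 'n set)" by simp
    show "map_permutation UNIV (inv_into ?I g) p \<in> {p. p permutes ?I}"
      using map_permutation_permutes[OF g' p'] by simp
    show "map_permutation ?I g (map_permutation UNIV (inv_into ?I g) p) = p"
      using map_permutation_compose_inv[OF g' p', of g] im by (simp add: f_inv_into_f)
  qed
qed

text \<open>With \<open>P\<close> the matrix whose columns are the basis vectors and
  \<open>A'\<close> the matrix of \<open>A\<close> in that basis, \<open>P ** A' = A ** P\<close>
  and \<open>det P \<noteq> 0\<close>. This allows the characteristic determinant to be computed in
  a basis adapted to the splitting.\<close>

lemma det_coord_mat:
  fixes A :: "real^'n::finite^'n"
  assumes bs: "is_basis bs UNIV"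
  shows "Determinant.det (coord_mat bs (\<lambda>v. A *v v)) = Determinants.det A"
proof -
  let ?n = "length bs" and ?r = "representation (set bs)"
  have dist: "distinct bs" and ind: "independent (set bs)" and sp: "span (set bs) = UNIV"
    using bs by (auto simp: is_basis_def)
  have "card (set bs) = dim (UNIV :: (real^'n) set)"
    using dim_eq_card_independent[OF ind] by (simp flip: sp add: dim_span)
  then have len: "?n = CARD('n)" using dist by (simp add: distinct_card)
  obtain g where g: "bij_betw g {..<?n} (UNIV :: 'n set)"
    using ex_bij_betw_nat_finite[of "UNIV :: 'n set"] len by (auto simp: lessThan_atLeast0)
  define h where "h = inv_into {..<?n} g"
  have h: "bij_betw h UNIV {..<?n}" unfolding h_def by (rule bij_betw_inv_into[OF g])
  have hg: "h (g i) = i" if "i < ?n" for i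
    unfolding h_def using g that by (simp add: bij_betw_inv_into_left)
  define P :: "real^'n^'n" where "P = (\<chi> i j. (bs ! h j) $ i)"
  define A' :: "real^'n^'n" where "A' = (\<chi> i j. ?r (A *v (bs ! h j)) (bs ! h i))"
  have P_axis: "P *v axis j 1 = bs ! h j" for j
    by (simp add: P_def matrix_vector_mult_basis column_def Finite_Cartesian_Product.vec_eq_iff)
  have bh: "bij_betw (\<lambda>k. bs ! h k) UNIV (set bs)"
    using bij_betw_trans[OF h bij_betw_nth[OF dist refl refl]] by (simp add: o_def)
  have rep: "(\<Sum>k\<in>UNIV. ?r v (bs ! h k) *\<^sub>R (bs ! h k)) = v" for v
  proof -
    have "(\<Sum>k\<in>UNIV. ?r v (bs ! h k) *\<^sub>R (bs ! h k)) = (\<Sum>b\<in>set bs. ?r v b *\<^sub>R b)"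
      by (rule sum.reindex_bij_betw[OF bh, of "\<lambda>b. ?r v b *\<^sub>R b"])
    also have "\<dots> = v" using ind sp by (intro real_vector.sum_representation_eq) auto
    finally show ?thesis .
  qed
  have PA: "P ** A' = A ** P"
  proof -
    have "(P ** A') $ i $ j = (A ** P) $ i $ j" for i j
    proof -
      have "(P ** A') $ i $ j = (\<Sum>k\<in>UNIV. ?r (A *v (bs ! h j)) (bs ! h k) *\<^sub>R (bs ! h k)) $ i"
        by (simp add: matrix_matrix_mult_def P_def A'_def mult.commute)
      also have "\<dots> = (A *v (bs ! h j)) $ i" by (simp only: rep)
      also have "\<dots> = (A ** P) $ i $ j"
        by (simp add: matrix_matrix_mult_def P_def matrix_vector_mult_def)
      finally show ?thesis .
    qed
    then show ?thesis unfolding Finite_Cartesian_Product.vec_eq_iff by blast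
  qed
  have "surj (\<lambda>v. P *v v)"
  proof -
    have "v = P *v (\<chi> k. ?r v (bs ! h k))" for v
    proof -
      have "P *v (\<chi> k. ?r v (bs ! h k)) = (\<Sum>k\<in>UNIV. ?r v (bs ! h k) *\<^sub>R (bs ! h k))"
        by (simp add: P_def Finite_Cartesian_Product.vec_eq_iff matrix_vector_mult_def mult.commute)
      then show ?thesis by (simp add: rep)
    qed
    then show ?thesis by (rule surjI[OF sym])
  qed
  then have "Determinants.det P \<noteq> 0"
    by (simp add: invertible_det_nz[symmetric] invertible_right_inverse matrix_right_invertible_surjective)
  then have "Determinants.det A' = Determinants.det A"
    using arg_cong[OF PA, of Determinants.det] by (simp add: Determinants.det_mul)
  moreover have "coord_mat bs (\<lambda>v. A *v v) = Matrix.mat ?n ?n (\<lambda>(i, j). A' $ g i $ g j)"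
    by (rule eq_matI) (auto simp: coord_mat_def A'_def hg)
  ultimately show ?thesis using det_reindex[OF g, of A'] by simp
qed

subsection \<open>Jacobi's formula\<close>

text \<open>Jacobi's formula. The product rule turns the Leibniz sum into a sum over
  \<open>i\<close> of determinants in which row \<open>i\<close> of \<open>F x\<close> is replaced
  by row \<open>i\<close> of \<open>D\<close>; Laplace expansion along that row produces the
  cofactors.\<close>

lemma has_real_derivative_det:
  assumes F: "\<And>s. F s \<in> carrier_mat n n" and D: "D \<in> carrier_mat n n"
    and deriv: "\<And>i j. i < n \<Longrightarrow> j < n \<Longrightarrow>
      ((\<lambda>s. F s $$ (i, j)) has_real_derivative D $$ (i, j)) (at x)"
  shows "((\<lambda>s. Determinant.det (F s)) has_real_derivative tr_mat (adj_mat (F x) * D)) (at x)"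
proof -
  let ?P = "{p. p permutes {0..<n}}" and ?A = "F x"
  let ?R = "\<lambda>i. Matrix.mat n n (\<lambda>(j, k). if j = i then D $$ (j, k) else ?A $$ (j, k))"
  have R: "Determinant.det (?R i) = (\<Sum>p\<in>?P. of_int (sign p) *
      (D $$ (i, p i) * (\<Prod>j\<in>{0..<n} - {i}. ?A $$ (j, p j))))" if i: "i < n" for i
  proof (subst det_def'[where n = n], simp, intro sum.cong refl arg_cong2[where f = "(*)"])
    fix p assume p: "p \<in> ?P"
    then have pn: "p j < n" if "j < n" for j using that permutes_in_image[of p "{0..<n}" j] by auto
    have "(\<Prod>j = 0..<n. ?R i $$ (j, p j)) = ?R i $$ (i, p i) * (\<Prod>j\<in>{0..<n} - {i}. ?R i $$ (j, p j))"
      using i by (intro prod.remove) auto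
    also have "\<dots> = D $$ (i, p i) * (\<Prod>j\<in>{0..<n} - {i}. ?A $$ (j, p j))"
      using i pn by (intro arg_cong2[where f = "(*)"] prod.cong) auto
    finally show "(\<Prod>j = 0..<n. ?R i $$ (j, p j)) = D $$ (i, p i) * (\<Prod>j\<in>{0..<n} - {i}. ?A $$ (j, p j))" .
  qed
  \<comment> \<open>The replaced row is the one deleted, so the cofactors along it are those of
    \<open>F x\<close>.\<close>
  have minor: "mat_delete (?R i) i j = mat_delete ?A i j" if "i < n" for i j
    using F[of x] that by (intro eq_matI) (auto simp: mat_delete_def)
  have "((\<lambda>s. \<Sum>p\<in>?P. of_int (sign p) * (\<Prod>i = 0..<n. F s $$ (i, p i))) has_real_derivative
      (\<Sum>p\<in>?P. of_int (sign p) *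
        (\<Sum>i = 0..<n. D $$ (i, p i) * (\<Prod>j\<in>{0..<n} - {i}. ?A $$ (j, p j))))) (at x)"
  proof (intro DERIV_sum DERIV_cmult has_field_derivative_prod deriv)
    fix p i assume "p \<in> ?P" "i \<in> {0..<n}"
    then show "i < n" "p i < n" using permutes_in_image[of p "{0..<n}" i] by auto
  qed
  moreover have "(\<lambda>s. Determinant.det (F s)) =
      (\<lambda>s. \<Sum>p\<in>?P. of_int (sign p) * (\<Prod>i = 0..<n. F s $$ (i, p i)))"
    using det_def'[OF F] by blast
  moreover have "(\<Sum>p\<in>?P. of_int (sign p) *
        (\<Sum>i = 0..<n. D $$ (i, p i) * (\<Prod>j\<in>{0..<n} - {i}. ?A $$ (j, p j))))
      = tr_mat (adj_mat ?A * D)"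
  proof -
    have "(\<Sum>p\<in>?P. of_int (sign p) *
        (\<Sum>i = 0..<n. D $$ (i, p i) * (\<Prod>j\<in>{0..<n} - {i}. ?A $$ (j, p j))))
      = (\<Sum>i = 0..<n. Determinant.det (?R i))"
      by (simp add: R sum_distrib_left sum.swap[of _ "{0..<n}"])
    also have "\<dots> = (\<Sum>i<n. \<Sum>j<n. D $$ (i, j) * cofactor ?A i j)"
      by (simp add: lessThan_atLeast0[symmetric] minor cofactor_def
          laplace_expansion_row[where n = n])
    also have "\<dots> = (\<Sum>j<n. \<Sum>i<n. cofactor ?A i j * D $$ (i, j))"
      by (subst sum.swap) (simp add: mult.commute)
    also have "\<dots> = tr_mat (adj_mat ?A * D)"
      using F[of x] D by (simp add: tr_mat_def adj_mat_def scalar_prod_def lessThan_atLeast0)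
    finally show ?thesis .
  qed
  ultimately show ?thesis by simp
qed

lemma tr_mat_mult_add:
  assumes "A \<in> carrier_mat n n" "B \<in> carrier_mat n n" "C \<in> carrier_mat n n"
  shows "tr_mat (A * (B + C)) = tr_mat (A * B) + tr_mat (A * (C :: 'a::semiring_0 mat))"
proof -
  have "A * (B + C) = A * B + A * C" by (rule mult_add_distrib_mat[OF assms])
  then show ?thesis using assms by (simp add: tr_mat_def sum.distrib)
qed

lemma tr_mat_mult_uminus:
  assumes "A \<in> carrier_mat n n" "B \<in> carrier_mat n n"
  shows "tr_mat (A * - B) = - tr_mat (A * (B :: 'a::ring mat))"
  using assms by (simp add: tr_mat_def scalar_prod_def sum_negf)

text \<open>Both sides are directional derivatives of a determinant, hence linear in the direction; the
  off-diagonal blocks \<open>Q\<close> and \<open>R\<close> contribute nothing because they only produce block-triangular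
  perturbations, whose determinant is constant.\<close>

lemma tr_adj_mat_four_block:
  fixes A :: "real mat"
  assumes A: "A \<in> carrier_mat n n" and D: "D \<in> carrier_mat m m"
    and P: "P \<in> carrier_mat n n" and Q: "Q \<in> carrier_mat n m"
    and R: "R \<in> carrier_mat m n" and S: "S \<in> carrier_mat m m"
  shows "tr_mat (adj_mat (four_block_mat A (0\<^sub>m n m) (0\<^sub>m m n) D) * four_block_mat P Q R S) =
    tr_mat (adj_mat A * P) * Determinant.det D + Determinant.det A * tr_mat (adj_mat D * S)"
proof -
  let ?M = "four_block_mat A (0\<^sub>m n m) (0\<^sub>m m n) D"
  let ?d = "\<lambda>B. tr_mat (adj_mat ?M * B)"
  have lin: "((\<lambda>s. a + s * b) has_real_derivative b) (at 0)" for a b :: real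
    by (auto intro!: derivative_eq_intros)
  have line: "((\<lambda>s. Determinant.det (N + s \<cdot>\<^sub>m B)) has_real_derivative tr_mat (adj_mat N * B)) (at 0)"
    if N: "N \<in> carrier_mat k k" and B: "B \<in> carrier_mat k k" for N B :: "real mat" and k
  proof -
    have "((\<lambda>s. Determinant.det (N + s \<cdot>\<^sub>m B)) has_real_derivative tr_mat (adj_mat (N + 0 \<cdot>\<^sub>m B) * B)) (at 0)"
      using N B lin by (intro has_real_derivative_det[where n = k]) auto
    moreover have "N + 0 \<cdot>\<^sub>m B = N" using N B by (intro eq_matI) auto
    ultimately show ?thesis by simp
  qed
  have M: "?M \<in> carrier_mat (n + m) (n + m)" using A D by simp
  have adjM: "adj_mat ?M \<in> carrier_mat (n + m) (n + m)" by (rule adj_mat(1)[OF M])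
  let ?B1 = "four_block_mat P (0\<^sub>m n m) (0\<^sub>m m n) S"
  let ?B2 = "four_block_mat (0\<^sub>m n n) Q (0\<^sub>m m n) (0\<^sub>m m m)"
  let ?B3 = "four_block_mat (0\<^sub>m n n) (0\<^sub>m n m) R (0\<^sub>m m m)"
  have carr: "?B1 \<in> carrier_mat (n + m) (n + m)" "?B2 \<in> carrier_mat (n + m) (n + m)"
      "?B3 \<in> carrier_mat (n + m) (n + m)" using P S by simp_all
  have split: "four_block_mat P Q R S = ?B1 + (?B2 + ?B3)"
    using P Q R S by (intro eq_matI) auto
  have "?d ?B1 = tr_mat (adj_mat A * P) * Determinant.det D + Determinant.det A * tr_mat (adj_mat D * S)"
  proof (rule DERIV_unique[OF line[OF M carr(1)]])
    have "?M + s \<cdot>\<^sub>m ?B1 = four_block_mat (A + s \<cdot>\<^sub>m P) (0\<^sub>m n m) (0\<^sub>m m n) (D + s \<cdot>\<^sub>m S)" for s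
      using A D P S by (intro eq_matI) auto
    then have "(\<lambda>s. Determinant.det (?M + s \<cdot>\<^sub>m ?B1)) =
        (\<lambda>s. Determinant.det (A + s \<cdot>\<^sub>m P) * Determinant.det (D + s \<cdot>\<^sub>m S))"
      using A D P S by (intro ext) (simp add: det_four_block_mat_lower_left_zero[where n = n and m = m])
    moreover have "A + 0 \<cdot>\<^sub>m P = A" "D + 0 \<cdot>\<^sub>m S = D" using A D P S by (auto intro!: eq_matI)
    ultimately show "((\<lambda>s. Determinant.det (?M + s \<cdot>\<^sub>m ?B1)) has_real_derivative
        tr_mat (adj_mat A * P) * Determinant.det D + Determinant.det A * tr_mat (adj_mat D * S)) (at 0)"
      using DERIV_mult[OF line[OF A P] line[OF D S]] by (simp add: mult.commute add.commute)
  qed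
  moreover have "?d ?B2 = 0"
  proof (rule DERIV_unique[OF line[OF M carr(2)]])
    have "?M + s \<cdot>\<^sub>m ?B2 = four_block_mat A (s \<cdot>\<^sub>m Q) (0\<^sub>m m n) D" for s
      using A D Q by (intro eq_matI) auto
    then show "((\<lambda>s. Determinant.det (?M + s \<cdot>\<^sub>m ?B2)) has_real_derivative 0) (at 0)"
      using A D Q by (simp add: det_four_block_mat_lower_left_zero[where n = n and m = m])
  qed
  moreover have "?d ?B3 = 0"
  proof (rule DERIV_unique[OF line[OF M carr(3)]])
    have "?M + s \<cdot>\<^sub>m ?B3 = four_block_mat A (0\<^sub>m n m) (s \<cdot>\<^sub>m R) D" for s
      using A D R by (intro eq_matI) auto
    then show "((\<lambda>s. Determinant.det (?M + s \<cdot>\<^sub>m ?B3)) has_real_derivative 0) (at 0)"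
      using A D R by (simp add: det_four_block_mat_upper_right_zero[where n = n and m = m])
  qed
  ultimately show ?thesis unfolding split
    using adjM carr by (simp add: tr_mat_mult_add[where n = "n + m"])
qed

text \<open>The matrix is \<open>x - N\<close> for the nilpotent Jordan block \<open>N\<close> and
  its adjugate is \<open>x + N\<close>; the entry 1 of \<open>N\<close> picks out
  \<open>P $$ (1, 0)\<close>, which later becomes \<open>2 * a\<close>.\<close>

lemma tr_adj_mat_2:
  fixes x :: real
  assumes P: "P \<in> carrier_mat 2 2"
  shows "tr_mat (adj_mat (Matrix.mat 2 2 (\<lambda>(i, j). if i = j then x else if i < j then -1 else 0)) * P) =
    x * (P $$ (0, 0) + P $$ (1, 1)) + P $$ (1, 0)"
  using P
  by (simp add: tr_mat_def adj_mat_def scalar_prod_def cofactor_def numeral_2_eq_2 lessThan_Suc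
      det_single mat_delete_def algebra_simps)

section \<open>Characteristic polynomial and adjugate as polynomials in the spectral
  parameter\<close>

lemma poly_cofactor: "poly (cofactor M i j) x = cofactor (map_mat (\<lambda>f. poly f x) M) i j"
proof -
  have "mat_delete (map_mat (\<lambda>f. poly f x) M) i j = map_mat (\<lambda>f. poly f x) (mat_delete M i j)"
    unfolding mat_delete_def by (rule eq_matI) auto
  then show ?thesis by (simp add: cofactor_def comm_ring_hom.hom_det[OF poly_hom.comm_ring_hom_axioms])
qed

lemma map_mat_poly_char_poly_matrix:
  assumes "M \<in> carrier_mat n n"
  shows "map_mat (\<lambda>f. poly f x) (char_poly_matrix M) = x \<cdot>\<^sub>m 1\<^sub>m n - M"
  using assms by (intro eq_matI) (auto simp: char_poly_matrix_def)

lemma poly_char_poly: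
  assumes "M \<in> carrier_mat n n"
  shows "poly (char_poly M) x = Determinant.det (x \<cdot>\<^sub>m 1\<^sub>m n - M)"
  unfolding map_mat_poly_char_poly_matrix[OF assms, symmetric] 
  by (simp add: char_poly_def comm_ring_hom.hom_det[OF poly_hom.comm_ring_hom_axioms])

text \<open>This is the polynomial \<open>tr (adj (x - M) S)\<close>. Writing it through cofactors
  over the polynomial ring makes evaluation and extraction of coefficients both act term by
  term.\<close>

definition tr_adj_poly :: "real mat \<Rightarrow> real mat \<Rightarrow> real poly" where
  "tr_adj_poly M S =
    (\<Sum>i<dim_row M. \<Sum>k<dim_row M. Polynomial.smult (S $$ (k, i)) (cofactor (char_poly_matrix M) k i))"

lemma poly_tr_adj_poly:
  assumes "M \<in> carrier_mat n n" "S \<in> carrier_mat n n"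
  shows "poly (tr_adj_poly M S) x = tr_mat (adj_mat (x \<cdot>\<^sub>m 1\<^sub>m n - M) * S)"
  using assms
  by (simp add: tr_adj_poly_def poly_sum poly_cofactor map_mat_poly_char_poly_matrix
      tr_mat_def adj_mat_def scalar_prod_def lessThan_atLeast0 mult.commute)

lemma coeff_tr_adj_poly:
  assumes "M \<in> carrier_mat n n" "S \<in> carrier_mat n n"
  shows "coeff (tr_adj_poly M S) j = tr_mat (adj_coeff M (int j) * S)"
  using assms
  by (simp add: tr_adj_poly_def coeff_sum adj_coeff_def char_poly_matrix_def
      tr_mat_def adj_mat_def scalar_prod_def lessThan_atLeast0 mult.commute)

subsection \<open>Derivatives along a line\<close>

lemma has_vector_derivative_vec:
  fixes f :: "real \<Rightarrow> 'a::euclidean_space^'n::finite"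
  assumes "\<And>i. ((\<lambda>s. f s $ i) has_vector_derivative D $ i) (at x)"
  shows "(f has_vector_derivative D) (at x)"
  unfolding has_vector_derivative_def
proof (subst has_derivative_componentwise_within, intro ballI)
  fix b :: "'a^'n" assume "b \<in> Basis"
  then obtain i u where b: "b = axis i u" by (auto simp: Basis_vec_def)
  have "((\<lambda>s. f s $ i \<bullet> u) has_derivative (\<lambda>h. (h *\<^sub>R D $ i) \<bullet> u)) (at x)"
    using assms[of i] unfolding has_vector_derivative_def by (rule has_derivative_inner_left)
  then show "((\<lambda>s. f s \<bullet> b) has_derivative (\<lambda>h. (h *\<^sub>R D) \<bullet> b)) (at x)"
    by (simp add: b inner_axis)
qed

lemma bounded_linear_matrix_vector_mult_left:
  "bounded_linear (\<lambda>A :: real^'n::finite^'m::finite. A *v v)"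
  by (intro linear_linear[THEN iffD2] linearI)
    (simp_all add: matrix_vector_mult_add_rdistrib scaleR_matrix_vector_assoc)

lemma has_vector_derivative_entry:
  fixes F :: "real \<Rightarrow> real^'n::finite^'m::finite"
  assumes "(F has_vector_derivative D) (at x)"
  shows "((\<lambda>s. F s $ i $ j) has_real_derivative D $ i $ j) (at x)"
  unfolding has_real_derivative_iff_has_vector_derivative
  by (rule bounded_linear.has_vector_derivative[OF bounded_linear_vec_nth])
    (rule bounded_linear.has_vector_derivative[OF bounded_linear_vec_nth assms])

lemma minor_sum_has_derivative:
  fixes F :: "real \<Rightarrow> real^'n::finite^'n"
  assumes "(F has_vector_derivative D) (at x)"
  shows "((\<lambda>s. minor_sum k (F s)) has_real_derivative deriv (\<lambda>s. minor_sum k (F s)) x) (at x)"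
proof -
  have *: "((\<lambda>s. minor_sum k (F s)) has_real_derivative
      (\<Sum>S | S \<subseteq> UNIV \<and> card S = k. \<Sum>\<sigma> | \<sigma> permutes S. of_int (sign \<sigma>) *
        (\<Sum>i\<in>S. D $ i $ \<sigma> i * (\<Prod>j\<in>S - {i}. F x $ j $ \<sigma> j)))) (at x)"
    unfolding minor_sum_def principal_minor_def
    by (intro DERIV_sum DERIV_cmult has_field_derivative_prod has_vector_derivative_entry[OF assms])
  show ?thesis unfolding DERIV_imp_deriv[OF *] by (rule *)
qed

lemma has_vector_derivative_directional:
  fixes X :: "real^'n::finite \<Rightarrow> real^'n"
  assumes "Ck_on 2 U X" "p \<in> U"
  shows "((\<lambda>s. frechet_derivative X (at (p + s *\<^sub>R q)) v) has_vector_derivative D2 X p q v) (at 0)"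
proof -
  let ?f = "\<lambda>x. frechet_derivative X (at x) v"
  have "?f differentiable (at p)" using assms by (simp add: numeral_2_eq_2)
  then have f: "(?f has_derivative frechet_derivative ?f (at p)) (at p)"
    by (simp add: frechet_derivative_works)
  then have lin: "linear (frechet_derivative ?f (at p))" by (rule has_derivative_linear)
  have "((\<lambda>s. p + s *\<^sub>R q) has_derivative (\<lambda>h. h *\<^sub>R q)) (at (0::real))"
    by (auto intro!: derivative_eq_intros)
  from has_derivative_compose[OF this, of ?f "frechet_derivative ?f (at p)"] f
  show ?thesis unfolding has_vector_derivative_def D2_def by (simp add: linear_scale[OF lin])
qed

text \<open>\<open>vector_derivative\<close> is a choice operator, so differentiability has to be
  established before \<open>dir_jacobian\<close> means anything; it is obtained entry by entry from
  the second derivatives along the axes.\<close>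

lemma jacobian_line_has_derivative:
  fixes X :: "real^'n::finite \<Rightarrow> real^'n"
  assumes "Ck_on 2 U X" "p \<in> U"
  shows "((\<lambda>s. jacobian X (at (p + s *\<^sub>R q))) has_vector_derivative dir_jacobian X p q) (at 0)"
proof -
  have "((\<lambda>s. jacobian X (at (p + s *\<^sub>R q))) has_vector_derivative
      (\<chi> i j. D2 X p q (axis j 1) $ i)) (at 0)"
  proof (intro has_vector_derivative_vec)
    fix i j
    show "((\<lambda>s. jacobian X (at (p + s *\<^sub>R q)) $ i $ j) has_vector_derivative
        (\<chi> i j. D2 X p q (axis j 1) $ i) $ i $ j) (at 0)"
      using bounded_linear.has_vector_derivative[OF bounded_linear_vec_nth
          has_vector_derivative_directional[OF assms]]
      by (simp add: jacobian_def matrix_def)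
  qed
  then show ?thesis unfolding dir_jacobian_def by (simp add: vector_derivative_at)
qed

text \<open>This is the identity \<open>L w = B(q, w)\<close>: both sides are the derivative at
  \<open>0\<close> of the same curve \<open>s \<mapsto> DX(p + s q) v\<close>. Jacobian and Frechet
  derivative agree only while the line stays in \<open>U\<close>, whence the open set
  \<open>?V\<close>.\<close>

lemma dir_jacobian_mult:
  fixes X :: "real^'n::finite \<Rightarrow> real^'n"
  assumes U: "open U" and X: "Ck_on 2 U X" and p: "p \<in> U"
  shows "dir_jacobian X p q *v v = D2 X p q v"
proof (rule vector_derivative_unique_at)
  show "((\<lambda>s. jacobian X (at (p + s *\<^sub>R q)) *v v) has_vector_derivative dir_jacobian X p q *v v) (at 0)"
    by (rule bounded_linear.has_vector_derivative[OF bounded_linear_matrix_vector_mult_left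
          jacobian_line_has_derivative[OF X p]])
  let ?V = "(\<lambda>s. p + s *\<^sub>R q) -` U"
  have V: "open ?V" by (intro open_vimage U continuous_intros)
  show "((\<lambda>s. jacobian X (at (p + s *\<^sub>R q)) *v v) has_vector_derivative D2 X p q v) (at 0)"
  proof (rule has_vector_derivative_transform_within_open[OF has_vector_derivative_directional[OF X p] V])
    show "0 \<in> ?V" using p by simp
    fix s assume "s \<in> ?V"
    then have "X differentiable (at (p + s *\<^sub>R q))" using X by (simp add: numeral_2_eq_2)
    then have "linear (frechet_derivative X (at (p + s *\<^sub>R q)))"
      using frechet_derivative_works has_derivative_linear by blast
    then show "frechet_derivative X (at (p + s *\<^sub>R q)) v = jacobian X (at (p + s *\<^sub>R q)) *v v"
      by (simp add: jacobian_def matrix_works)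
  qed
qed

section \<open>Quadratic vector fields with prescribed derivatives\<close>

lemma Ck_on_const: "Ck_on k UNIV (\<lambda>x. c)"
  by (induction k arbitrary: c) simp_all

lemma Ck_on_affine:
  assumes "bounded_linear f"
  shows "Ck_on k UNIV (\<lambda>x. c + f x)"
proof (cases k)
  case 0
  then show ?thesis by (simp add: continuous_intros linear_continuous_on[OF assms])
next
  case (Suc m)
  have "((\<lambda>x. c + f x) has_derivative f) (at x)" for x
    using bounded_linear_imp_has_derivative[OF assms] by (auto intro!: derivative_eq_intros)
  then have "frechet_derivative (\<lambda>x. c + f x) (at x) = f" "(\<lambda>x. c + f x) differentiable (at x)" for x
    using frechet_derivative_at[symmetric] differentiableI by blast+
  then show ?thesis by (simp add: Suc Ck_on_const)
qed

text \<open>The quadratic part of \<open>X\<close> comes from the symmetric bilinear form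
  \<open>B(u,w) = \<phi>(u) L w + \<phi>(w) L u - \<phi>(u) \<phi>(w) L q\<close> with \<open>\<phi>(q) = 1\<close>, so that \<open>B(q,w) = L w\<close>.\<close>

lemma smooth_field_with_prescribed_derivatives:
  fixes J L :: "real^'n::finite^'n" and p q :: "real^'n"
  assumes "q \<noteq> 0"
  obtains X :: "real^'n \<Rightarrow> real^'n" where "smooth_on UNIV X" "X p = 0"
    "\<And>s. jacobian X (at (p + s *\<^sub>R q)) = J + s *\<^sub>R L"
proof -
  define c where "c = q /\<^sub>R (q \<bullet> q)"
  have qc: "q \<bullet> c = 1" using assms by (simp add: c_def)
  \<comment> \<open>With \<open>h = x - p\<close> and \<open>\<phi>(h) = h \<bullet> c\<close>, this
    is \<open>J h + B(h,h) / 2\<close>, and \<open>D x\<close> below is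
    \<open>J + B(x - p, _)\<close>.\<close>
  define X where "X x = J *v (x - p) + ((x - p) \<bullet> c) *\<^sub>R (L *v (x - p))
      - (1/2 * ((x - p) \<bullet> c)^2) *\<^sub>R (L *v q)" for x
  define D where "D x h = J *v h + (((x - p) \<bullet> c) *\<^sub>R (L *v h) + (h \<bullet> c) *\<^sub>R (L *v (x - p)))
      - (((x - p) \<bullet> c) * (h \<bullet> c)) *\<^sub>R (L *v q)" for x h
  have mv: "((\<lambda>x. A *v (x - p)) has_derivative (\<lambda>h. A *v h)) (at x)" for A :: "real^'n^'n" and x
    by (rule bounded_linear.has_derivative[OF matrix_vector_mul_bounded_linear])
      (auto intro!: derivative_eq_intros)
  have X': "(X has_derivative D x) (at x)" for x
    unfolding X_def[abs_def] D_def
    by (rule derivative_eq_intros mv refl)+ (auto simp: algebra_simps)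
  then have fd: "frechet_derivative X (at x) = D x" for x
    by (rule frechet_derivative_at[symmetric])
  have "Ck_on k UNIV X" for k
  proof (cases k)
    case 0
    have "continuous_on UNIV X" 
      by (rule has_derivative_continuous_on[where f' = D]) (rule has_derivative_at_withinI[OF X'])
    then show ?thesis by (simp add: 0)
  next
    case (Suc m)
    \<comment> \<open>For fixed \<open>h\<close> the derivative is affine in the base point, because
      the quadratic part comes from a bilinear form; smoothness therefore reduces to
      \<open>Ck_on_affine\<close>.\<close>
    have "Ck_on m UNIV (\<lambda>x. D x h)" for h
    proof -
      let ?f = "\<lambda>x. (x \<bullet> c) *\<^sub>R (L *v h) + (h \<bullet> c) *\<^sub>R (L *v x) - ((x \<bullet> c) * (h \<bullet> c)) *\<^sub>R (L *v q)"
      have "bounded_linear ?f"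
        by (intro linear_linear[THEN iffD2] linearI)
          (simp_all add: algebra_simps matrix_vector_right_distrib inner_left_distrib)
      moreover have "D x h = (J *v h - ?f p) + ?f x" for x
        by (simp add: D_def algebra_simps matrix_vector_mult_diff_distrib inner_diff_left)
      ultimately show ?thesis using Ck_on_affine[of ?f m "J *v h - ?f p"] by presburger
    qed
    then show ?thesis using X' by (auto simp: Suc fd differentiable_def)
  qed
  then have "smooth_on UNIV X" by (simp add: smooth_on_def)
  moreover have "X p = 0" by (simp add: X_def)
  moreover have "jacobian X (at (p + s *\<^sub>R q)) = J + s *\<^sub>R L" for s
  proof -
    \<comment> \<open>On the line \<open>\<phi>(s q) = s\<close>, so the two terms with
      \<open>L *v q\<close> cancel and only \<open>s *\<^sub>R (L *v h)\<close> is left.\<close>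
    have "D (p + s *\<^sub>R q) = (*v) (J + s *\<^sub>R L)"
      by (rule ext) (simp add: D_def qc matrix_vector_mult_add_rdistrib scaleR_matrix_vector_assoc
          matrix_vector_mult_scaleR algebra_simps)
    then show ?thesis by (simp add: jacobian_def fd)
  qed
  ultimately show ?thesis using that by blast
qed

subsection \<open>The splitting into centre and transverse part\<close>

text \<open>Compare coefficients of \<open>x^m\<close> in
  \<open>adj (x - M) (x - M) = \<chi>(x) I\<close>. The entries of the adjugate have degree below
  \<open>m\<close>, so the left side contributes its coefficient at \<open>m - 1\<close>, while
  \<open>\<chi>\<close> is monic. This identifies the trace term for \<open>e_1\<close>.\<close>

lemma adj_coeff_top:
  assumes M: "M \<in> carrier_mat m m" and m: "m > 0"
  shows "adj_coeff M (int m - 1) = 1\<^sub>m m"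
proof (rule eq_matI)
  let ?C = "char_poly_matrix M" and ?A = "adj_mat (char_poly_matrix M)"
  have C: "?C \<in> carrier_mat m m" using M by simp
  have A: "?A \<in> carrier_mat m m" by (rule adj_mat(1)[OF C])
  fix i j assume "i < dim_row (1\<^sub>m m :: real mat)" "j < dim_col (1\<^sub>m m :: real mat)"
  then have i: "i < m" and j: "j < m" by simp_all
  have high: "coeff (?A $$ (i, k)) m = 0" if k: "k < m" for k
  proof -
    have "degree (Determinant.det (mat_delete ?C k i)) \<le> 1 * (m - 1)"
      using C M by (intro degree_det_le) (auto simp: mat_delete_def char_poly_matrix_def)
    moreover have "?A $$ (i, k) = (-1) ^ (k + i) * Determinant.det (mat_delete ?C k i)"
      using C i k by (simp add: adj_mat_def cofactor_def)
    ultimately have "degree (?A $$ (i, k)) < m" using m by (cases "even (k + i)") auto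
    then show ?thesis by (rule coeff_eq_0)
  qed
  have "(?A * ?C) $$ (i, j) = (\<Sum>k<m. ?A $$ (i, k) * ?C $$ (k, j))"
    using A C i j by (simp add: scalar_prod_def lessThan_atLeast0)
  also have "\<dots> = (\<Sum>k<m. (if k = j then [:0, 1:] * ?A $$ (i, k) else 0) - Polynomial.smult (M $$ (k, j)) (?A $$ (i, k)))"
    using M j by (intro sum.cong) (auto simp: char_poly_matrix_def algebra_simps)
  also have "\<dots> = [:0, 1:] * ?A $$ (i, j) - (\<Sum>k<m. Polynomial.smult (M $$ (k, j)) (?A $$ (i, k)))"
    using j by (simp add: sum_subtractf)
  finally have "coeff ((?A * ?C) $$ (i, j)) m = coeff (?A $$ (i, j)) (m - 1)"
    using m high by (simp add: coeff_sum coeff_pCons split: nat.splits)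
  moreover have "(?A * ?C) $$ (i, j) = (if i = j then char_poly M else 0)"
    using i j by (simp add: adj_mat(3)[OF C] char_poly_def)
  moreover have "coeff (char_poly M) m = 1" using degree_monic_char_poly[OF M] by simp
  ultimately show "adj_coeff M (int m - 1) $$ (i, j) = 1\<^sub>m m $$ (i, j)"
    using A i j m by (auto simp: adj_coeff_def nat_diff_distrib')
next
  show "dim_row (adj_coeff M (int m - 1)) = dim_row (1\<^sub>m m :: real mat)"
    "dim_col (adj_coeff M (int m - 1)) = dim_col (1\<^sub>m m :: real mat)"
    using M m by (simp_all add: adj_coeff_def adj_mat_def char_poly_matrix_def)
qed

lemma subspace_E_c: "subspace (E_c J)"
  unfolding E_c_def
  by (rule subspaceI) (simp_all add: matrix_vector_right_distrib matrix_vector_mult_scaleR)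

lemma subspace_E_tr: "subspace (E_tr J)"
  unfolding E_tr_def using linear_subspace_image[OF matrix_vector_mul_linear subspace_UNIV] by blast

lemma mult_E_tr: "v \<in> E_tr J \<Longrightarrow> J *v v \<in> E_tr J"
  unfolding E_tr_def by (auto simp flip: matrix_vector_mul_assoc)

text \<open>Directness makes \<open>J ** J\<close> injective on \<open>E_tr J\<close>, hence onto
  \<open>E_tr J\<close> by dimension. So \<open>J^2 v = J^2 w\<close> for some \<open>w\<close> in
  \<open>E_tr J\<close>, and \<open>v - w\<close> lies in the kernel of \<open>J^2\<close>;
  uniqueness is directness again.\<close>

lemma proj_along_properties:
  fixes v :: "real^'n::finite"
  assumes direct: "\<And>v. v \<in> E_c J \<Longrightarrow> v \<in> E_tr J \<Longrightarrow> v = 0"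
  shows "proj_along (E_tr J) (E_c J) v \<in> E_tr J" "v - proj_along (E_tr J) (E_c J) v \<in> E_c J"
    and "\<And>w. w \<in> E_tr J \<Longrightarrow> v - w \<in> E_c J \<Longrightarrow> proj_along (E_tr J) (E_c J) v = w"
proof -
  let ?f = "\<lambda>v. (J ** J) *v v"
  have lin: "linear ?f" by (rule matrix_vector_mul_linear)
  have unique: "w = w'" if "w \<in> E_tr J" "v - w \<in> E_c J" "w' \<in> E_tr J" "v - w' \<in> E_c J" for w w'
  proof -
    have "w - w' \<in> E_tr J" by (rule subspace_diff[OF subspace_E_tr that(1,3)])
    moreover have "w - w' \<in> E_c J" using subspace_diff[OF subspace_E_c that(4,2)] by simp
    ultimately have "w - w' = 0" using direct by blast
    then show ?thesis by simp
  qed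
  have "inj_on ?f (E_tr J)"
  proof (rule inj_onI)
    fix x y assume xy: "x \<in> E_tr J" "y \<in> E_tr J" "?f x = ?f y"
    then have "x - y \<in> E_c J" by (simp add: E_c_def matrix_vector_mult_diff_distrib)
    moreover have "x - y \<in> E_tr J" by (rule subspace_diff[OF subspace_E_tr xy(1,2)])
    ultimately have "x - y = 0" using direct by blast
    then show "x = y" by simp
  qed
  moreover have "span (E_tr J) = E_tr J" by (rule span_eq_iff[THEN iffD2, OF subspace_E_tr])
  ultimately have "dim (?f ` E_tr J) = dim (E_tr J)"
    using dim_image_eq[OF lin, of "E_tr J"] by metis
  moreover have "?f ` E_tr J \<subseteq> E_tr J" unfolding E_tr_def by blast
  ultimately have onto: "?f ` E_tr J = E_tr J"
    by (intro subspace_dim_equal linear_subspace_image[OF lin] subspace_E_tr) auto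
  have "?f v \<in> ?f ` E_tr J" unfolding onto by (simp add: E_tr_def)
  then obtain w where w: "?f v = ?f w" "w \<in> E_tr J" by (rule imageE)
  then have w': "v - w \<in> E_c J" by (simp add: E_c_def matrix_vector_mult_diff_distrib)
  have the: "proj_along (E_tr J) (E_c J) v = u" if "u \<in> E_tr J" "v - u \<in> E_c J" for u
    unfolding proj_along_def using that unique by blast
  show "\<And>w. w \<in> E_tr J \<Longrightarrow> v - w \<in> E_c J \<Longrightarrow> proj_along (E_tr J) (E_c J) v = w" by (rule the)
  show "proj_along (E_tr J) (E_c J) v \<in> E_tr J" "v - proj_along (E_tr J) (E_c J) v \<in> E_c J"
    using w w' the[OF w(2) w'] by simp_all
qed

lemma linear_proj_along:
  fixes J :: "real^'n::finite^'n"
  assumes direct: "\<And>v. v \<in> E_c J \<Longrightarrow> v \<in> E_tr J \<Longrightarrow> v = 0"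
  shows "linear (proj_along (E_tr J) (E_c J))"
proof (rule linearI)
  note P = proj_along_properties[OF direct]
  let ?P = "proj_along (E_tr J) (E_c J)"
  show "?P (x + y) = ?P x + ?P y" for x y
  proof (rule P(3))
    show "?P x + ?P y \<in> E_tr J" by (intro subspace_add subspace_E_tr P(1))
    have "(x - ?P x) + (y - ?P y) \<in> E_c J" by (intro subspace_add subspace_E_c P(2))
    then show "x + y - (?P x + ?P y) \<in> E_c J" by (simp add: algebra_simps)
  qed
  show "?P (r *\<^sub>R x) = r *\<^sub>R ?P x" for r x
  proof (rule P(3))
    show "r *\<^sub>R ?P x \<in> E_tr J" by (intro subspace_scale subspace_E_tr P(1))
    have "r *\<^sub>R (x - ?P x) \<in> E_c J" by (intro subspace_scale subspace_E_c P(2))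
    then show "r *\<^sub>R x - r *\<^sub>R ?P x \<in> E_c J" by (simp add: algebra_simps)
  qed
qed

lemma mat_mult_vec: "Finite_Cartesian_Product.mat x *v v = x *\<^sub>R (v :: real^'n::finite)"
proof -
  have "(\<Sum>j\<in>UNIV. (if i = j then x else 0) * v $ j) = (\<Sum>j\<in>UNIV. if i = j then x * v $ j else 0)" for i
    by (intro sum.cong) auto
  then show ?thesis
    by (simp add: Finite_Cartesian_Product.vec_eq_iff matrix_vector_mult_def Finite_Cartesian_Product.mat_def)
qed

text \<open>If \<open>J^3 u = 0\<close> then \<open>(x - J)(x^2 u + x J u + J^2 u) = x^3 u\<close>, so by Cramer's rule
  \<open>det (x - J)\<close> times each entry of \<open>J^2 u\<close> is \<open>o(x^2)\<close>; but the coefficient of \<open>x^2\<close> is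
  \<open>\<plusminus>e\<^sub>n\<^sub>-\<^sub>2(J)\<close>.\<close>

lemma no_nilpotent_chain:
  fixes J :: "real^'n::finite^'n"
  assumes n: "CARD('n) \<ge> 2" and e0: "minor_sum (CARD('n)) J = 0"
    and e1: "minor_sum (CARD('n) - 1) J = 0" and e2: "minor_sum (CARD('n) - 2) J \<noteq> 0"
    and J3: "J *v (J *v (J *v u)) = 0"
  shows "J *v (J *v u) = 0"
proof -
  let ?n = "CARD('n)"
  have "(J *v (J *v u)) $ k = 0" for k
  proof -
    \<comment> \<open>\<open>q x\<close> is \<open>det (x - J) / x^2\<close>, a polynomial since the
      last two minor sums vanish; \<open>w x\<close> solves \<open>(x - J) w = x^3 u\<close>;
      \<open>d x\<close> is the numerator in Cramer's rule for entry \<open>k\<close>.\<close>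
    define q where "q x = (\<Sum>j\<le>?n - 2. (-1) ^ j * minor_sum j J * x ^ (?n - 2 - j))" for x :: real
    define w where "w x = x^2 *\<^sub>R u + x *\<^sub>R (J *v u) + J *v (J *v u)" for x :: real
    define d where "d x = Determinants.det (\<chi> i j. if j = k then u $ i else
        (Finite_Cartesian_Product.mat x - J) $ i $ j)" for x :: real
    have split: "{..?n} = insert ?n (insert (?n - 1) {..?n - 2})" using n by auto
    have det: "Determinants.det (Finite_Cartesian_Product.mat x - J) = x^2 * q x" for x
    proof -
      have "Determinants.det (Finite_Cartesian_Product.mat x - J) =
          (\<Sum>j\<le>?n - 2. (-1) ^ j * minor_sum j J * x ^ (?n - j))"
        unfolding det_mat_minus split using n e0 e1 by (subst sum.insert; auto)+
      also have "\<dots> = (\<Sum>j\<le>?n - 2. x^2 * ((-1) ^ j * minor_sum j J * x ^ (?n - 2 - j)))"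
      proof (intro sum.cong refl)
        fix j assume "j \<in> {..?n - 2}"
        then have "?n - j = 2 + (?n - 2 - j)" using n by auto
        then show "(-1) ^ j * minor_sum j J * x ^ (?n - j) = x^2 * ((-1) ^ j * minor_sum j J * x ^ (?n - 2 - j))"
          by (simp only: power_add mult_ac)
      qed
      finally show ?thesis by (simp add: q_def sum_distrib_left)
    qed
    have mw: "(Finite_Cartesian_Product.mat x - J) *v w x = x^3 *\<^sub>R u" for x
      using J3
      by (simp add: w_def matrix_vector_mult_diff_rdistrib matrix_vector_right_distrib mat_mult_vec
          matrix_vector_mult_scaleR algebra_simps power2_eq_square power3_eq_cube)
    \<comment> \<open>Cramer's rule is applied to \<open>w x / x^3\<close>, so this is available
      only off \<open>0\<close>; continuity of both sides carries it to \<open>x = 0\<close>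
      below.\<close>
    have qd: "q x * w x $ k = x * d x" if "x \<noteq> 0" for x
    proof -
      have "(Finite_Cartesian_Product.mat x - J) *v (w x /\<^sub>R x^3) = u"
        using that by (simp add: matrix_vector_mult_scaleR mw)
      then have "d x = (w x /\<^sub>R x^3) $ k * (x^2 * q x)"
        using cramer_lemma[where k = k and x = "w x /\<^sub>R x^3" and A = "Finite_Cartesian_Product.mat x - J"]
        by (simp only: d_def det)
      then show ?thesis using that by (simp add: field_simps power2_eq_square power3_eq_cube)
    qed
    have "isCont (\<lambda>x. q x * w x $ k) 0"
      unfolding q_def w_def by (auto intro!: continuous_intros)
    then have lim1: "((\<lambda>x. q x * w x $ k) \<longlongrightarrow> q 0 * w 0 $ k) (at 0)" by (simp add: isCont_def)
    have entry: "isCont (\<lambda>x. if b then c else (if b' then x else 0) - e) 0" for b b' and c e :: real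
      by (cases b; cases b') (auto intro!: continuous_intros)
    have "isCont d 0"
      unfolding d_def Determinants.det_def Finite_Cartesian_Product.mat_def
        vector_minus_component vec_lambda_beta
      by (intro continuous_sum continuous_mult continuous_prod continuous_const entry)
    then have "isCont (\<lambda>x. x * d x) 0" by (intro continuous_intros)
    then have "((\<lambda>x. x * d x) \<longlongrightarrow> 0) (at 0)" by (simp add: isCont_def)
    moreover have "\<forall>\<^sub>F x in at 0. q x * w x $ k = x * d x"
      using qd by (auto simp: eventually_at intro: exI[of _ 1])
    ultimately have "((\<lambda>x. q x * w x $ k) \<longlongrightarrow> 0) (at 0)"
      using tendsto_cong[of "\<lambda>x. q x * w x $ k" "\<lambda>x. x * d x"] by blast
    then have "q 0 * w 0 $ k = 0" using LIM_unique[OF lim1] by blast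
    \<comment> \<open>Because \<open>0 ^ 0 = 1\<close>, exactly the summand
      \<open>j = CARD('n) - 2\<close> survives.\<close>
    moreover have "q 0 = (-1) ^ (?n - 2) * minor_sum (?n - 2) J"
      unfolding q_def by (subst sum.mono_neutral_right[of _ "{?n - 2}"]) auto
    ultimately show ?thesis using e2 by (simp add: w_def)
  qed
  then show ?thesis by (simp add: Finite_Cartesian_Product.vec_eq_iff)
qed

subsection \<open>Adapted bases\<close>

lemma det_nilpotent_resolvent:
  "Determinant.det (Matrix.mat 2 2 (\<lambda>(i, j). if i = j then x else if i < j then -1 else 0)) = (x :: real)^2"
  by (subst det_upper_triangular[where n = 2])
    (auto simp: upper_triangular_def diag_mat_def numeral_2_eq_2)

text \<open>Fixes the auxiliary choices behind \<open>BT_coefficients\<close> together with a basis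
  of \<open>E_tr J\<close>. Directness of the splitting is derived below rather than
  assumed.\<close>

locale BT_frame =
  fixes J :: "real^'n::finite^'n" and q0 q1 :: "real^'n" and p0 p1 :: "real^'n \<Rightarrow> real"
    and ws :: "(real^'n) list"
  assumes ker: "span {q0} = {v. J *v v = 0}" and Jq1: "J *v q1 = q0"
    and lin: "linear p0" "linear p1"
    and dual: "p0 q0 = 1" "p1 q1 = 1" "p0 q1 = 0" "p1 q0 = 0"
    and annihilate: "\<And>w. w \<in> E_tr J \<Longrightarrow> p0 w = 0" "\<And>w. w \<in> E_tr J \<Longrightarrow> p1 w = 0"
    and basis: "is_basis ws (E_tr J)"
begin

abbreviation tr_proj :: "real^'n \<Rightarrow> real^'n" where "tr_proj \<equiv> proj_along (E_tr J) (E_c J)"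
abbreviation "bs \<equiv> q0 # q1 # ws"
abbreviation "m \<equiv> length ws"
abbreviation "Jtr \<equiv> coord_mat ws (\<lambda>w. J *v w)"

lemma Jq0: "J *v q0 = 0"
  using ker span_base[of q0 "{q0}"] by blast

text \<open>Two kernel steps: \<open>J v\<close> lies in the kernel, so it equals
  \<open>\<beta> q0 = J (\<beta> q1)\<close>, and then \<open>v - \<beta> q1\<close> lies in the
  kernel as well.\<close>

lemma E_c_expand:
  assumes "v \<in> E_c J"
  obtains \<alpha> \<beta> where "v = \<alpha> *\<^sub>R q0 + \<beta> *\<^sub>R q1"
proof -
  have "J *v v \<in> span {q0}" using assms by (simp add: ker E_c_def matrix_vector_mul_assoc)
  then obtain \<beta> where "J *v v = \<beta> *\<^sub>R q0" by (auto simp: span_singleton)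
  then have "v - \<beta> *\<^sub>R q1 \<in> span {q0}"
    by (simp add: ker Jq1 matrix_vector_mult_diff_distrib matrix_vector_mult_scaleR)
  then obtain \<alpha> where "v - \<beta> *\<^sub>R q1 = \<alpha> *\<^sub>R q0" by (auto simp: span_singleton)
  then show ?thesis using that[of \<alpha> \<beta>] by (simp add: algebra_simps)
qed

lemma p_expand:
  "p0 (\<alpha> *\<^sub>R q0 + \<beta> *\<^sub>R q1) = \<alpha>" "p1 (\<alpha> *\<^sub>R q0 + \<beta> *\<^sub>R q1) = \<beta>"
  using lin dual by (simp_all add: linear_add linear_scale)

text \<open>The coordinates of a vector of \<open>E_c J\<close> are its values under
  \<open>p0\<close> and \<open>p1\<close>, and both covectors vanish on
  \<open>E_tr J\<close>.\<close>

lemma direct: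
  assumes "v \<in> E_c J" "v \<in> E_tr J"
  shows "v = 0"
proof -
  obtain \<alpha> \<beta> where v: "v = \<alpha> *\<^sub>R q0 + \<beta> *\<^sub>R q1" using E_c_expand assms(1) by blast
  have "\<alpha> = 0" "\<beta> = 0" using annihilate[OF assms(2)] p_expand[of \<alpha> \<beta>] by (simp_all add: v)
  then show ?thesis by (simp add: v)
qed

lemma proj:
  "tr_proj v \<in> E_tr J" "v - tr_proj v \<in> E_c J"
  "w \<in> E_tr J \<Longrightarrow> v - w \<in> E_c J \<Longrightarrow> tr_proj v = w"
  by (rule proj_along_properties(1), erule (1) direct, rule proj_along_properties(2), erule (1) direct,
      rule proj_along_properties(3), erule (1) direct, assumption+)

lemma decompose: "v = p0 v *\<^sub>R q0 + p1 v *\<^sub>R q1 + tr_proj v"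
proof -
  obtain \<alpha> \<beta> where v: "v - tr_proj v = \<alpha> *\<^sub>R q0 + \<beta> *\<^sub>R q1" using E_c_expand proj(2) by blast
  have "p0 (v - tr_proj v) = p0 v" "p1 (v - tr_proj v) = p1 v"
    using lin annihilate[OF proj(1)[of v]] by (simp_all add: linear_diff)
  then have "v - tr_proj v = p0 v *\<^sub>R q0 + p1 v *\<^sub>R q1" using p_expand[of \<alpha> \<beta>] by (simp add: v)
  then show ?thesis by (simp add: algebra_simps)
qed

lemma ws_basis: "distinct ws" "independent (set ws)" "span (set ws) = E_tr J"
  using basis by (auto simp: is_basis_def)

lemma ws_in: "w \<in> set ws \<Longrightarrow> w \<in> E_tr J"
  by (simp add: ws_basis(3)[symmetric] span_base)

lemma not_in_ws: "q0 \<notin> set ws" "q1 \<notin> set ws" "q0 \<noteq> q1"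
  using ws_in annihilate dual by (metis zero_neq_one)+

text \<open>The covectors separate \<open>q0\<close> and \<open>q1\<close> from the other basis
  vectors, which gives independence; \<open>decompose\<close> gives spanning.\<close>

lemma basis_full: "is_basis bs UNIV"
proof -
  have "q1 \<notin> span (set ws)" using annihilate dual ws_basis(3) by force
  then have "independent (insert q1 (set ws))" using ws_basis(2) by (rule independent_insertI)
  moreover have "p0 v = 0" if "v \<in> span (insert q1 (set ws))" for v
    using linear_eq_0_on_span[OF lin(1) _ that] dual annihilate ws_in by auto
  then have "q0 \<notin> span (insert q1 (set ws))" using dual(1) by force
  ultimately have "independent (set bs)" using independent_insertI by simp
  moreover have "span (set bs) = UNIV"
  proof -
    have "v \<in> span (set bs)" for v
    proof -
      have "tr_proj v \<in> span (set bs)"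
        using proj(1)[of v] span_mono[of "set ws" "set bs"] ws_basis(3) by auto
      then have "p0 v *\<^sub>R q0 + p1 v *\<^sub>R q1 + tr_proj v \<in> span (set bs)"
        by (intro span_add span_scale) (auto intro: span_base)
      then show ?thesis using decompose by simp
    qed
    then show ?thesis by auto
  qed
  ultimately show ?thesis using ws_basis not_in_ws by (simp add: is_basis_def)
qed

lemma card_eq: "CARD('n) = 2 + m"
proof -
  have ind: "independent (set bs)" and sp: "span (set bs) = UNIV" and dist: "distinct bs"
    using basis_full by (auto simp: is_basis_def)
  have "card (set bs) = dim (UNIV :: (real^'n) set)"
    using dim_eq_card_independent[OF ind] dim_span[of "set bs"] by (simp only: sp)
  then have "card (set bs) = CARD('n)" by (simp only: dim_UNIV DIM_cart DIM_real mult_1_right)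
  then show ?thesis using distinct_card[OF dist] by simp
qed

lemma representation_bs:
  "representation (set bs) v b =
    p0 v * (if b = q0 then 1 else 0) + p1 v * (if b = q1 then 1 else 0) + representation (set ws) (tr_proj v) b"
proof -
  have ind: "independent (set bs)" and sp: "\<And>v. v \<in> span (set bs)"
    using basis_full by (auto simp: is_basis_def)
  have "representation (set bs) v b = representation (set bs) (p0 v *\<^sub>R q0 + p1 v *\<^sub>R q1 + tr_proj v) b"
    using decompose[of v] by simp
  also have "\<dots> = p0 v * representation (set bs) q0 b + p1 v * representation (set bs) q1 b
      + representation (set bs) (tr_proj v) b"
    by (simp only: representation_add[OF ind sp sp] representation_scale[OF ind sp])
  also have "representation (set bs) (tr_proj v) = representation (set ws) (tr_proj v)"
    using ind proj(1) ws_basis(3) by (intro representation_extend) auto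
  finally show ?thesis using ind by (simp add: representation_basis eq_commute)
qed

lemma representation_bs_q:
  "representation (set bs) v q0 = p0 v" "representation (set bs) v q1 = p1 v"
  "w \<in> set ws \<Longrightarrow> representation (set bs) v w = representation (set ws) (tr_proj v) w"
proof -
  have outside: "representation (set ws) u b = 0" if "b \<notin> set ws" for u b
    using representation_ne_zero that by blast
  show "representation (set bs) v q0 = p0 v" "representation (set bs) v q1 = p1 v"
    using not_in_ws by (simp_all add: representation_bs outside del: list.set)
  assume "w \<in> set ws"
  then have "w \<noteq> q0" "w \<noteq> q1" using not_in_ws by auto
  then show "representation (set bs) v w = representation (set ws) (tr_proj v) w"
    by (simp add: representation_bs del: list.set)
qed

text \<open>The lower right block is the transverse part because coordinates along \<open>ws\<close>
  only see \<open>tr_proj\<close>. The off-diagonal blocks are left as they are, since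
  \<open>tr_adj_mat_four_block\<close> discards them.\<close>

lemma coord_mat_block:
  "coord_mat bs (\<lambda>v. B *v v) = four_block_mat
    (Matrix.mat 2 2 (\<lambda>(i, j). representation (set bs) (B *v (bs ! j)) (bs ! i)))
    (Matrix.mat 2 m (\<lambda>(i, j). representation (set bs) (B *v (ws ! j)) (bs ! i)))
    (Matrix.mat m 2 (\<lambda>(i, j). representation (set bs) (B *v (bs ! j)) (ws ! i)))
    (coord_mat ws (tr_part J B))"
  by (rule eq_matI)
    (auto simp: coord_mat_def tr_part_def representation_bs_q nth_Cons' numeral_2_eq_2 simp del: list.set)

text \<open>Both summands are invariant, so the off-diagonal blocks vanish; \<open>J q0 = 0\<close>
  and \<open>J q1 = q0\<close> give the nilpotent Jordan block in the upper left corner.\<close>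

lemma coord_mat_resolvent:
  "coord_mat bs (\<lambda>v. (Finite_Cartesian_Product.mat x - J) *v v) = four_block_mat
    (Matrix.mat 2 2 (\<lambda>(i, j). if i = j then x else if i < j then -1 else 0))
    (0\<^sub>m 2 m) (0\<^sub>m m 2) (x \<cdot>\<^sub>m 1\<^sub>m m - Jtr)"
proof -
  let ?R = "\<lambda>v. (Finite_Cartesian_Product.mat x - J) *v v"
  have R: "?R v = x *\<^sub>R v - J *v v" for v by (simp add: matrix_vector_mult_diff_rdistrib mat_mult_vec)
  have R_c: "?R q0 = x *\<^sub>R q0 + 0 *\<^sub>R q1" "?R q1 = (-1) *\<^sub>R q0 + x *\<^sub>R q1"
    by (simp_all add: R Jq0 Jq1)
  \<comment> \<open>After \<open>p_expand\<close>, the decomposition of this vector reads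
    \<open>v = v + tr_proj v\<close>.\<close>
  have proj_c: "tr_proj (\<alpha> *\<^sub>R q0 + \<beta> *\<^sub>R q1) = 0" for \<alpha> \<beta>
    using decompose[of "\<alpha> *\<^sub>R q0 + \<beta> *\<^sub>R q1"] unfolding p_expand by simp
  have proj_R: "tr_proj (?R q0) = 0" "tr_proj (?R q1) = 0" unfolding R_c by (rule proj_c)+
  have ws: "ws ! j \<in> E_tr J" if "j < m" for j using that ws_in by simp
  have R_tr: "?R w \<in> E_tr J" if "w \<in> E_tr J" for w
    unfolding R using that by (intro subspace_diff subspace_scale subspace_E_tr mult_E_tr)
  have proj_tr: "tr_proj w = w" if "w \<in> E_tr J" for w
    using that subspace_0[OF subspace_E_c] by (intro proj(3)) auto
  have "representation (set ws) (?R (ws ! j)) (ws ! i) =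
      (if i = j then x else 0) - representation (set ws) (J *v (ws ! j)) (ws ! i)"
    if i: "i < m" and j: "j < m" for i j
  proof -
    have sp: "ws ! j \<in> span (set ws)" "J *v (ws ! j) \<in> span (set ws)"
      using ws[OF j] mult_E_tr ws_basis(3) by auto
    have "representation (set ws) (?R (ws ! j)) (ws ! i) =
        x * representation (set ws) (ws ! j) (ws ! i) - representation (set ws) (J *v (ws ! j)) (ws ! i)"
      unfolding R using ws_basis(2) sp by (simp add: representation_diff representation_scale span_scale)
    then show ?thesis using i j ws_basis(1,2)
      by (simp add: representation_basis nth_eq_iff_index_eq)
  qed
  then have "coord_mat ws (tr_part J (Finite_Cartesian_Product.mat x - J)) = x \<cdot>\<^sub>m 1\<^sub>m m - Jtr"
    using R_tr ws by (intro eq_matI) (auto simp: coord_mat_def tr_part_def proj_tr)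
  moreover have "Matrix.mat 2 2 (\<lambda>(i, j). representation (set bs) (?R (bs ! j)) (bs ! i)) =
      Matrix.mat 2 2 (\<lambda>(i, j). if i = j then x else if i < j then -1 else 0)"
    by (rule eq_matI) (auto simp: less_2_cases_iff representation_bs_q R_c dual
        linear_scale[OF lin(1)] linear_scale[OF lin(2)] linear_diff[OF lin(1)] linear_diff[OF lin(2)]
        simp del: list.set)
  moreover have "Matrix.mat 2 m (\<lambda>(i, j). representation (set bs) (?R (ws ! j)) (bs ! i)) = 0\<^sub>m 2 m"
    using R_tr ws annihilate by (intro eq_matI) (auto simp: less_2_cases_iff representation_bs_q simp del: list.set)
  moreover have "Matrix.mat m 2 (\<lambda>(i, j). representation (set bs) (?R (bs ! j)) (ws ! i)) = 0\<^sub>m m 2"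
    by (rule eq_matI) (auto simp: less_2_cases_iff representation_bs_q proj_R representation_zero simp del: list.set)
  ultimately show ?thesis unfolding coord_mat_block by simp
qed


section \<open>The characteristic polynomial along a curve of matrices through
  \<open>J\<close>\<close>

context
  fixes F :: "real \<Rightarrow> real^'n^'n" and L :: "real^'n^'n"
  assumes F: "(F has_vector_derivative L) (at 0)" and F0: "F 0 = J"
begin

abbreviation "Ltr \<equiv> coord_mat ws (tr_part J L)"
abbreviation "D k \<equiv> deriv (\<lambda>s. minor_sum k (F s)) 0"

lemma carrier_tr: "Jtr \<in> carrier_mat m m" "Ltr \<in> carrier_mat m m"
  by (simp_all add: coord_mat_def)

text \<open>The determinant of the block-diagonal resolvent is \<open>x^2\<close> times the
  characteristic polynomial of the transverse block; this ties the \<open>e_k(J)\<close> to the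
  \<open>c_j\<close>.\<close>

lemma sum_minor_sum:
  "(\<Sum>k\<le>CARD('n). (-1) ^ k * minor_sum k J * x ^ (CARD('n) - k)) = x^2 * poly (char_poly Jtr) x"
proof -
  have "(\<Sum>k\<le>CARD('n). (-1) ^ k * minor_sum k J * x ^ (CARD('n) - k)) =
      Determinant.det (coord_mat bs (\<lambda>v. (Finite_Cartesian_Product.mat x - J) *v v))"
    by (simp only: det_mat_minus det_coord_mat[OF basis_full])
  also have "\<dots> = Determinant.det (Matrix.mat 2 2 (\<lambda>(i, j). if i = j then x else if i < j then -1 else 0))
      * poly (char_poly Jtr) x"
    unfolding coord_mat_resolvent poly_char_poly[OF carrier_tr(1)] using carrier_tr
    by (intro det_four_block_mat_lower_left_zero[where n = 2 and m = m]) auto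
  finally show ?thesis by (simp add: det_nilpotent_resolvent)
qed

text \<open>Both sides are the derivative at \<open>s = 0\<close> of \<open>det (x - F s)\<close>:
  the left one through \<open>det_mat_minus\<close>, the right one through Jacobi's formula in the
  adapted basis.\<close>

lemma sum_deriv_minor_sum:
  "(\<Sum>k\<le>CARD('n). (-1) ^ k * D k * x ^ (CARD('n) - k)) =
    - ((p1 (L *v q0) + (p0 (L *v q0) + p1 (L *v q1)) * x) * poly (char_poly Jtr) x
      + x^2 * poly (tr_adj_poly Jtr Ltr) x)"
proof (rule DERIV_unique)
  let ?d = "\<lambda>s. Determinant.det (coord_mat bs (\<lambda>v. (Finite_Cartesian_Product.mat x - F s) *v v))"
  have d: "?d = (\<lambda>s. \<Sum>k\<le>CARD('n). (-1) ^ k * minor_sum k (F s) * x ^ (CARD('n) - k))"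
    by (simp only: det_mat_minus det_coord_mat[OF basis_full])
  show "(?d has_real_derivative (\<Sum>k\<le>CARD('n). (-1) ^ k * D k * x ^ (CARD('n) - k))) (at 0)"
    unfolding d by (intro DERIV_sum DERIV_cmult_right DERIV_cmult minor_sum_has_derivative[OF F])
  let ?G = "\<lambda>s. coord_mat bs (\<lambda>v. (Finite_Cartesian_Product.mat x - F s) *v v)"
  \<comment> \<open>The direction is the derivative \<open>- L\<close> of \<open>x - F s\<close>,
    the source of the overall minus sign.\<close>
  let ?H = "coord_mat bs (\<lambda>v. (- L) *v v)"
  have "(?d has_real_derivative tr_mat (adj_mat (?G 0) * ?H)) (at 0)"
  proof (rule has_real_derivative_det)
    show "?G s \<in> carrier_mat (2 + m) (2 + m)" "?H \<in> carrier_mat (2 + m) (2 + m)" for s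
      by (simp_all add: coord_mat_def)
    fix i j assume "i < 2 + m" "j < 2 + m"
    have ind: "independent (set bs)" "span (set bs) = UNIV" using basis_full by (auto simp: is_basis_def)
    have "((\<lambda>s. Finite_Cartesian_Product.mat x - F s) has_vector_derivative (0 - L)) (at 0)"
      by (intro has_vector_derivative_diff has_vector_derivative_const F)
    from bounded_linear.has_vector_derivative[OF bounded_linear_representation[OF ind]
        bounded_linear.has_vector_derivative[OF bounded_linear_matrix_vector_mult_left this]]
    show "((\<lambda>s. ?G s $$ (i, j)) has_real_derivative ?H $$ (i, j)) (at 0)"
      using \<open>i < 2 + m\<close> \<open>j < 2 + m\<close>
      by (simp add: coord_mat_def has_real_derivative_iff_has_vector_derivative del: list.set)
  qed
  moreover have "tr_mat (adj_mat (?G 0) * ?H) =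
    - ((p1 (L *v q0) + (p0 (L *v q0) + p1 (L *v q1)) * x) * poly (char_poly Jtr) x
      + x^2 * poly (tr_adj_poly Jtr Ltr) x)"
  proof -
    let ?N = "Matrix.mat 2 2 (\<lambda>(i, j). if i = j then x else if i < j then -1 else (0::real))"
    let ?K = "coord_mat bs (\<lambda>v. L *v v)"
    have "(- L) *v v = - (L *v v)" for v by (simp add: matrix_vector_mult_def sum_negf Finite_Cartesian_Product.vec_eq_iff)
    moreover have "independent (set bs)" "\<And>v. v \<in> span (set bs)" using basis_full by (auto simp: is_basis_def)
    ultimately have H: "?H = - ?K"
      by (intro eq_matI) (auto simp: coord_mat_def representation_neg simp del: list.set)
    have "?G 0 \<in> carrier_mat (2 + m) (2 + m)" by (simp add: coord_mat_def)
    then have "adj_mat (?G 0) \<in> carrier_mat (2 + m) (2 + m)" by (rule adj_mat(1))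
    then have "tr_mat (adj_mat (?G 0) * ?H) = - tr_mat (adj_mat (?G 0) * ?K)"
      unfolding H by (rule tr_mat_mult_uminus) (simp add: coord_mat_def)
    also have "tr_mat (adj_mat (?G 0) * ?K) =
        tr_mat (adj_mat ?N * Matrix.mat 2 2 (\<lambda>(i, j). representation (set bs) (L *v (bs ! j)) (bs ! i)))
          * Determinant.det (x \<cdot>\<^sub>m 1\<^sub>m m - Jtr)
        + Determinant.det ?N * tr_mat (adj_mat (x \<cdot>\<^sub>m 1\<^sub>m m - Jtr) * Ltr)"
      unfolding F0 coord_mat_resolvent coord_mat_block[of L] using carrier_tr
      by (intro tr_adj_mat_four_block[where n = 2 and m = m]) auto
    \<comment> \<open>For the vector field this linear factor in \<open>x\<close> becomes
      \<open>2 * a + b * x\<close>.\<close>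
    also have "tr_mat (adj_mat ?N * Matrix.mat 2 2 (\<lambda>(i, j). representation (set bs) (L *v (bs ! j)) (bs ! i)))
        = p1 (L *v q0) + (p0 (L *v q0) + p1 (L *v q1)) * x"
      by (subst tr_adj_mat_2) (simp_all add: representation_bs_q del: list.set)
    finally show ?thesis
      by (simp add: det_nilpotent_resolvent poly_char_poly[OF carrier_tr(1)] poly_tr_adj_poly[OF carrier_tr])
  qed
  ultimately show "(?d has_real_derivative - ((p1 (L *v q0) + (p0 (L *v q0) + p1 (L *v q1)) * x) * poly (char_poly Jtr) x
      + x^2 * poly (tr_adj_poly Jtr Ltr) x)) (at 0)"
    by simp
qed

lemma coeff_sum_monom:
  assumes "\<rho> \<le> CARD('n)"
  shows "coeff (\<Sum>k\<le>CARD('n). monom ((-1) ^ k * f k) (CARD('n) - k)) \<rho> =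
    (-1) ^ (CARD('n) - \<rho>) * f (CARD('n) - \<rho>)"
proof -
  have "coeff (\<Sum>k\<le>CARD('n). monom ((-1) ^ k * f k) (CARD('n) - k)) \<rho> =
      (\<Sum>k\<le>CARD('n). if k = CARD('n) - \<rho> then (-1) ^ k * f k else 0)"
    unfolding coeff_sum using assms by (intro sum.cong) auto
  then show ?thesis by simp
qed

text \<open>An identity for all real \<open>x\<close> is one of polynomials. The factor
  \<open>x^2\<close> shifts the index by two, and the convention for negative indices in
  \<open>char_coeff\<close> covers \<open>\<rho> < 2\<close>.\<close>

lemma minor_sum_eq:
  assumes "\<rho> \<le> CARD('n)"
  shows "(-1) ^ (CARD('n) - \<rho>) * minor_sum (CARD('n) - \<rho>) J = char_coeff Jtr (int \<rho> - 2)"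
proof -
  have "(\<Sum>k\<le>CARD('n). monom ((-1) ^ k * minor_sum k J) (CARD('n) - k)) = monom 1 2 * char_poly Jtr"
    using sum_minor_sum
    by (intro iffD1[OF poly_eq_poly_eq_iff] ext) (simp add: poly_sum poly_monom)
  then have "(-1) ^ (CARD('n) - \<rho>) * minor_sum (CARD('n) - \<rho>) J = coeff (monom 1 2 * char_poly Jtr) \<rho>"
    using coeff_sum_monom[OF assms, of "\<lambda>k. minor_sum k J"] by (simp only:)
  then show ?thesis by (auto simp: coeff_monom_mult char_coeff_def nat_diff_distrib')
qed

text \<open>Comparison of coefficients at \<open>\<rho>\<close>: the linear factor contributes the
  shifts by zero and one, \<open>x^2\<close> the shift by two, again with zero at negative
  indices.\<close>

lemma deriv_minor_sum_eq:
  assumes "\<rho> \<le> CARD('n)"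
  shows "(-1) ^ (CARD('n) - \<rho>) * D (CARD('n) - \<rho>) =
    - (p1 (L *v q0) * char_coeff Jtr (int \<rho>) +
        (p0 (L *v q0) + p1 (L *v q1)) * char_coeff Jtr (int \<rho> - 1))
    - tr_mat (adj_coeff Jtr (int \<rho> - 2) * Ltr)"
proof -
  let ?b = "p0 (L *v q0) + p1 (L *v q1)"
  have "(\<Sum>k\<le>CARD('n). monom ((-1) ^ k * D k) (CARD('n) - k)) =
      - ([:p1 (L *v q0), ?b:] * char_poly Jtr + monom 1 2 * tr_adj_poly Jtr Ltr)"
  proof (intro iffD1[OF poly_eq_poly_eq_iff] ext)
    fix x
    have "poly (\<Sum>k\<le>CARD('n). monom ((-1) ^ k * D k) (CARD('n) - k)) x =
        (\<Sum>k\<le>CARD('n). (-1) ^ k * D k * x ^ (CARD('n) - k))"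
      by (simp add: poly_sum poly_monom)
    also have "\<dots> = poly (- ([:p1 (L *v q0), ?b:] * char_poly Jtr + monom 1 2 * tr_adj_poly Jtr Ltr)) x"
      unfolding sum_deriv_minor_sum by (simp add: poly_monom algebra_simps)
    finally show "poly (\<Sum>k\<le>CARD('n). monom ((-1) ^ k * D k) (CARD('n) - k)) x =
        poly (- ([:p1 (L *v q0), ?b:] * char_poly Jtr + monom 1 2 * tr_adj_poly Jtr Ltr)) x" .
  qed
  then have "(-1) ^ (CARD('n) - \<rho>) * D (CARD('n) - \<rho>) =
      coeff (- ([:p1 (L *v q0), ?b:] * char_poly Jtr + monom 1 2 * tr_adj_poly Jtr Ltr)) \<rho>"
    using coeff_sum_monom[OF assms, of "\<lambda>k. D k"] by (simp only:)
  also have "\<dots> = - (p1 (L *v q0) * char_coeff Jtr (int \<rho>) + ?b * char_coeff Jtr (int \<rho> - 1))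
      - coeff (monom 1 2 * tr_adj_poly Jtr Ltr) \<rho>"
    by (cases \<rho>) (simp_all add: char_coeff_def nat_add_distrib)
  also have "coeff (monom 1 2 * tr_adj_poly Jtr Ltr) \<rho> = tr_mat (adj_coeff Jtr (int \<rho> - 2) * Ltr)"
    using carrier_tr
    by (auto simp: coeff_monom_mult coeff_tr_adj_poly[OF carrier_tr] of_nat_diff adj_coeff_def tr_mat_def)
  finally show ?thesis .
qed

end

end

subsection \<open>The derivative formulas\<close>

lemma BT_derivative_formulas:
  fixes X :: "real^'n::finite \<Rightarrow> real^'n"
  assumes n: "CARD('n) \<ge> 3" and U: "open U" and X: "Ck_on 2 U X" and p: "p \<in> U"
    and J: "J = jacobian X (at p)" and ker: "span {q0} = {v. J *v v = 0}"
    and BT: "BT_coefficients X p q0 a b" and basis: "is_basis ws (E_tr J)"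
  defines "Jtr \<equiv> coord_mat ws (\<lambda>w. J *v w)"
    and "Ltr \<equiv> coord_mat ws (tr_part J (dir_jacobian X p q0))"
  shows "\<rho> \<le> CARD('n) \<Longrightarrow> (-1) ^ (CARD('n) - \<rho>) * dir_e X p q0 (CARD('n) - \<rho>) =
      - (2 * a * char_coeff Jtr (int \<rho>) + b * char_coeff Jtr (int \<rho> - 1))
      - tr_mat (adj_coeff Jtr (int \<rho> - 2) * Ltr)"
    and "dir_e X p q0 (CARD('n)) = - 2 * a * minor_sum (CARD('n) - 2) J"
    and "dir_e X p q0 (CARD('n) - 1) = b * minor_sum (CARD('n) - 2) J - 2 * a * minor_sum (CARD('n) - 3) J"
    and "dir_e X p q0 1 = b + tr_mat Ltr"
proof -
  let ?L = "dir_jacobian X p q0"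
  obtain q1 p0 p1 where q1: "J *v q1 = q0" and lin: "linear p0" "linear p1"
    and dual: "p0 q0 = 1" "p1 q1 = 1" "p0 q1 = 0" "p1 q0 = 0"
    and ann: "\<forall>w\<in>E_tr J. p0 w = 0" "\<forall>w\<in>E_tr J. p1 w = 0"
    and ab: "a = 1/2 * p1 (D2 X p q0 q0)" "b = p0 (D2 X p q0 q0) + p1 (D2 X p q0 q1)"
    using BT unfolding BT_coefficients_def Let_def J[symmetric]
    by (elim exE conjE) (rule that)
  interpret BT_frame J q0 q1 p0 p1 ws
    by (rule BT_frame.intro[OF ker q1 lin dual bspec[OF ann(1)] bspec[OF ann(2)] basis])
  have Jtr: "Jtr \<in> carrier_mat m m" and Ltr: "Ltr \<in> carrier_mat m m"
    by (simp_all add: Jtr_def Ltr_def coord_mat_def)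
  have F: "((\<lambda>s. jacobian X (at (p + s *\<^sub>R q0))) has_vector_derivative ?L) (at 0)"
    by (rule jacobian_line_has_derivative[OF X p])
  have F0: "jacobian X (at (p + 0 *\<^sub>R q0)) = J" by (simp add: J)
  \<comment> \<open>\<open>dir_jacobian_mult\<close> turns \<open>L v\<close> into
    \<open>B(q0, v)\<close>; the factor 2 undoes the \<open>1/2\<close> in the definition of
    \<open>a\<close>.\<close>
  have coeffs: "p1 (?L *v q0) = 2 * a" "p0 (?L *v q0) + p1 (?L *v q1) = b"
    by (simp_all add: ab dir_jacobian_mult[OF U X p])
  show main: "(-1) ^ (CARD('n) - \<rho>) * dir_e X p q0 (CARD('n) - \<rho>) =
      - (2 * a * char_coeff Jtr (int \<rho>) + b * char_coeff Jtr (int \<rho> - 1))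
      - tr_mat (adj_coeff Jtr (int \<rho> - 2) * Ltr)" if "\<rho> \<le> CARD('n)" for \<rho>
    using deriv_minor_sum_eq[OF F F0 that] unfolding coeffs dir_e_def Jtr_def Ltr_def .
  note e = minor_sum_eq[OF F F0, folded Jtr_def]
  have neg: "char_coeff Jtr (-1) = 0" "tr_mat (adj_coeff Jtr (-2) * Ltr) = 0" "tr_mat (adj_coeff Jtr (-1) * Ltr) = 0"
    using Jtr Ltr by (simp_all add: char_coeff_def adj_coeff_def tr_mat_def)
  \<comment> \<open>With \<open>l = n - 3\<close> every sign that occurs is \<open>(-1) ^ l\<close>
    times a fixed sign, so it can be cancelled by \<open>sgn\<close>.\<close>
  obtain l where m: "m = Suc l" using n card_eq by (cases m) auto
  have card: "CARD('n) = l + 3" using card_eq m by simp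
  have c0: "char_coeff Jtr 0 = (-1) ^ Suc l * minor_sum (CARD('n) - 2) J"
    using e[of 2] by (simp add: card)
  have c1: "char_coeff Jtr 1 = (-1) ^ l * minor_sum (CARD('n) - 3) J"
    using e[of 3] by (simp add: card)
  have sgn: "(-1) ^ l * x = (-1) ^ l * y \<longleftrightarrow> x = y" for x y :: real by simp
  have "(-1) ^ l * dir_e X p q0 (CARD('n)) = (-1) ^ l * (- 2 * a * minor_sum (CARD('n) - 2) J)"
    using main[of 0] by (simp add: neg c0 power_add card mult_ac)
  then show "dir_e X p q0 (CARD('n)) = - 2 * a * minor_sum (CARD('n) - 2) J" unfolding sgn .
  have "(-1) ^ l * dir_e X p q0 (CARD('n) - 1) =
      (-1) ^ l * (b * minor_sum (CARD('n) - 2) J - 2 * a * minor_sum (CARD('n) - 3) J)"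
    using main[of 1] by (simp add: neg c0 c1 power_add card algebra_simps)
  then show "dir_e X p q0 (CARD('n) - 1) = b * minor_sum (CARD('n) - 2) J - 2 * a * minor_sum (CARD('n) - 3) J"
    unfolding sgn .
  \<comment> \<open>The case \<open>\<rho> = n - 1 = m + 1\<close>: a monic polynomial of degree
    \<open>m\<close> has \<open>c_m = 1\<close> and \<open>c_(m+1) = 0\<close>, and the top
    coefficient of the adjugate is the identity.\<close>
  have "char_coeff Jtr (int m) = 1" "char_coeff Jtr (int (Suc m)) = 0"
    using degree_monic_char_poly[OF Jtr] by (simp_all add: char_coeff_def coeff_eq_0 nat_add_distrib)
  moreover have "adj_coeff Jtr (int m - 1) * Ltr = Ltr"
    using adj_coeff_top[OF Jtr] Ltr m by (simp only: left_mult_one_mat zero_less_Suc)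
  ultimately show "dir_e X p q0 1 = b + tr_mat Ltr"
    using main[of "Suc m"] card_eq by (simp add: algebra_simps)
qed

text \<open>Directness for a bare matrix \<open>J\<close>, where no dual covectors are given. For
  \<open>v = J^2 u\<close> with \<open>J^2 v = 0\<close>, \<open>no_nilpotent_chain\<close> is
  applied first to \<open>J u\<close> and then to \<open>u\<close>; the vanishing of
  \<open>e_n(J)\<close> it requires comes from the kernel vector \<open>q\<close>.\<close>

lemma E_c_Int_E_tr:
  fixes J :: "real^'n::finite^'n"
  assumes n: "CARD('n) \<ge> 2" and e1: "minor_sum (CARD('n) - 1) J = 0"
    and e2: "minor_sum (CARD('n) - 2) J \<noteq> 0" and q: "q \<noteq> 0" "J *v q = 0"
    and v: "v \<in> E_c J" "v \<in> E_tr J"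
  shows "v = 0"
proof -
  have "Determinants.det (Finite_Cartesian_Product.mat 0 - J) = 0"
  proof (rule ccontr)
    assume "Determinants.det (Finite_Cartesian_Product.mat 0 - J) \<noteq> 0"
    then obtain B where "B ** (Finite_Cartesian_Product.mat 0 - J) = Finite_Cartesian_Product.mat 1"
      by (auto simp: invertible_det_nz[symmetric] invertible_def)
    then have "B *v ((Finite_Cartesian_Product.mat 0 - J) *v q) = q"
      by (simp add: matrix_vector_mul_assoc)
    moreover have "(Finite_Cartesian_Product.mat 0 - J) *v q = 0"
      by (simp only: matrix_vector_mult_diff_rdistrib mat_mult_vec q(2)) simp
    ultimately show False using q(1) by simp
  qed
  \<comment> \<open>At \<open>x = 0\<close> only \<open>k = CARD('n)\<close> contributes, through
    \<open>0 ^ 0 = 1\<close>.\<close>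
  moreover have "(\<Sum>k\<le>CARD('n). (-1) ^ k * minor_sum k J * 0 ^ (CARD('n) - k)) =
      (-1) ^ CARD('n) * minor_sum (CARD('n)) J"
    by (subst sum.mono_neutral_right[of _ "{CARD('n)}"]) auto
  ultimately have "(-1) ^ CARD('n) * minor_sum (CARD('n)) J = 0" by (simp only: det_mat_minus)
  then have e0: "minor_sum (CARD('n)) J = 0" by simp
  note chain = no_nilpotent_chain[OF n e0 e1 e2]
  obtain u where u: "v = J *v (J *v u)" using v(2) by (auto simp: E_tr_def matrix_vector_mul_assoc)
  have "J *v (J *v v) = 0" using v(1) by (simp add: E_c_def matrix_vector_mul_assoc)
  then have "J *v v = 0" unfolding u by (rule chain)
  then show "v = 0" unfolding u by (rule chain)
qed

text \<open>A zero generator would make \<open>J\<close> injective and hence of full rank.\<close>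

lemma kernel_generator_nonzero:
  fixes J :: "real^'n::finite^'n"
  assumes "rank J = CARD('n) - 1" "span {q} = {v. J *v v = 0}"
  shows "q \<noteq> 0"
proof
  assume "q = 0"
  then have "inj ((*v) J)" using assms(2) by (auto simp: linear_injective_0[OF matrix_vector_mul_linear])
  then have "rank J = CARD('n)" by (simp add: full_rank_injective)
  then show False using assms(1) zero_less_card_finite[where 'a = 'n] by linarith
qed

theorem proposition5p5:
  assumes n_ge_3: "CARD('n::finite) \<ge> 3"
  shows
    "(\<forall>(U :: (real^'n) set) (X :: real^'n \<Rightarrow> real^'n) p q0 a b J L ws Jtr Ltr c t.
        open U \<and> Ck_on 2 U X \<and> p \<in> U \<and> X p = 0 \<and>
        J = jacobian X (at p) \<and>
        rank J = CARD('n) - 1 \<and>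
        minor_sum (CARD('n) - 1) J = 0 \<and> minor_sum (CARD('n) - 2) J \<noteq> 0 \<and>
        span {q0} = {v. J *v v = 0} \<and>
        BT_coefficients X p q0 a b \<and>
        L = dir_jacobian X p q0 \<and>
        is_basis ws (E_tr J) \<and>
        Jtr = coord_mat ws (\<lambda>w. J *v w) \<and>
        Ltr = coord_mat ws (tr_part J L) \<and>
        c = char_coeff Jtr \<and>
        t = (\<lambda>j. tr_mat (adj_coeff Jtr j * Ltr))
        \<longrightarrow>
        (\<forall>\<rho> \<le> CARD('n) - 1.
           (-1) ^ (CARD('n) - \<rho>) * dir_e X p q0 (CARD('n) - \<rho>) =
             - (2 * a * c (int \<rho>) + b * c (int \<rho> - 1)) - t (int \<rho> - 2)) \<and>
        dir_e X p q0 (CARD('n)) = - 2 * a * minor_sum (CARD('n) - 2) J \<and>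
        dir_e X p q0 (CARD('n) - 1) =
          b * minor_sum (CARD('n) - 2) J - 2 * a * minor_sum (CARD('n) - 3) J \<and>
        dir_e X p q0 1 = b + tr_mat Ltr)
     \<and>
     (\<forall>(J :: real^'n^'n) q0 p.
        rank J = CARD('n) - 1 \<and>
        minor_sum (CARD('n) - 1) J = 0 \<and> minor_sum (CARD('n) - 2) J \<noteq> 0 \<and>
        span {q0} = {v. J *v v = 0}
        \<longrightarrow>
        (\<forall>L :: real^'n^'n. \<exists>X :: real^'n \<Rightarrow> real^'n.
           smooth_on UNIV X \<and> X p = 0 \<and> jacobian X (at p) = J \<and>
           ((\<lambda>s. jacobian X (at (p + s *\<^sub>R q0))) has_vector_derivative L) (at 0)) \<and>
        (\<forall>M. endomorphism_of (E_tr J) M \<longrightarrow>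
           (\<exists>X :: real^'n \<Rightarrow> real^'n.
              smooth_on UNIV X \<and> X p = 0 \<and> jacobian X (at p) = J \<and>
              (\<forall>w \<in> E_tr J. tr_part J (dir_jacobian X p q0) w = M w))))"
proof ((rule conjI; intro allI impI), goal_cases)
  case (1 U X p q0 a b J L ws Jtr Ltr c t)
  then have h: "open U" "Ck_on 2 U X" "p \<in> U" "J = jacobian X (at p)" "span {q0} = {v. J *v v = 0}"
    "BT_coefficients X p q0 a b" "is_basis ws (E_tr J)"
    and L: "L = dir_jacobian X p q0" and tr: "Jtr = coord_mat ws (\<lambda>w. J *v w)" "Ltr = coord_mat ws (tr_part J L)"
      "c = char_coeff Jtr" "t = (\<lambda>j. tr_mat (adj_coeff Jtr j * Ltr))" by argo+
  note f = BT_derivative_formulas[OF n_ge_3 h, folded L, folded tr(1,2), folded tr(3)]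
  have "\<forall>\<rho> \<le> CARD('n) - 1. (-1) ^ (CARD('n) - \<rho>) * dir_e X p q0 (CARD('n) - \<rho>) =
      - (2 * a * c (int \<rho>) + b * c (int \<rho> - 1)) - t (int \<rho> - 2)"
    unfolding tr(4) using f(1) diff_le_self le_trans by blast
  with f(2-4) show ?case by blast
next
  case (2 J q0 p)
  show ?case
  proof (intro conjI allI impI, goal_cases)
    case (1 L)
    from 2 have "q0 \<noteq> 0" using kernel_generator_nonzero by blast
    then obtain X :: "real^'n \<Rightarrow> real^'n" where X: "smooth_on UNIV X" "X p = 0"
      "\<And>s. jacobian X (at (p + s *\<^sub>R q0)) = J + s *\<^sub>R L"
      using smooth_field_with_prescribed_derivatives by blast
    have "((\<lambda>s. J + s *\<^sub>R L) has_vector_derivative L) (at 0)"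
      by (auto intro!: derivative_eq_intros)
    then show ?case using X(1,2) X(3)[of 0] by (auto simp: X(3) intro!: exI[of _ X])
  next
    case M: (2 M)
    from 2 have q0: "q0 \<noteq> 0" using kernel_generator_nonzero by blast
    have "J *v q0 = 0" using 2 span_base[of q0 "{q0}"] by blast
    then have direct: "v = 0" if "v \<in> E_c J" "v \<in> E_tr J" for v
      using E_c_Int_E_tr[of J q0 v] 2 q0 n_ge_3 that by simp
    note P = proj_along_properties[of J, OF direct]
    let ?P = "proj_along (E_tr J) (E_c J)"
    have linP: "linear ?P" by (rule linear_proj_along[OF direct])
    have M_in: "M x \<in> E_tr J" and M_scale: "M (r *\<^sub>R x) = r *\<^sub>R M x" if "x \<in> E_tr J" for x r
      using M that by (auto simp: endomorphism_of_def)
    have M_add: "M (x + y) = M x + M y" if "x \<in> E_tr J" "y \<in> E_tr J" for x y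
      using M that by (auto simp: endomorphism_of_def)
    \<comment> \<open>Extends \<open>M\<close> by zero on \<open>E_c J\<close>; since
      \<open>?P\<close> is the identity on \<open>E_tr J\<close>, the transverse part of this
      \<open>L\<close> is \<open>M\<close>.\<close>
    define L where "L = matrix (\<lambda>v. M (?P v))"
    have "linear (\<lambda>v. M (?P v))"
      by (rule linearI) (simp_all add: linear_add[OF linP] linear_scale[OF linP] M_add M_scale P(1))
    then have L: "L *v v = M (?P v)" for v by (simp add: L_def matrix_works)
    have P_id: "?P w = w" if "w \<in> E_tr J" for w
      using that subspace_0[OF subspace_E_c] by (intro P(3)) auto
    obtain X :: "real^'n \<Rightarrow> real^'n" where X: "smooth_on UNIV X" "X p = 0"
      "\<And>s. jacobian X (at (p + s *\<^sub>R q0)) = J + s *\<^sub>R L"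
      using smooth_field_with_prescribed_derivatives q0 by blast
    have "((\<lambda>s. J + s *\<^sub>R L) has_vector_derivative L) (at 0)"
      by (auto intro!: derivative_eq_intros)
    then have "dir_jacobian X p q0 = L" unfolding dir_jacobian_def X(3) by (rule vector_derivative_at)
    then have "tr_part J (dir_jacobian X p q0) w = M w" if "w \<in> E_tr J" for w
      using that by (simp add: tr_part_def L P_id M_in)
    then show ?case using X(1,2) X(3)[of 0] by (auto intro!: exI[of _ X])
  qed
qed

end
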